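(* Let $\mathcal{T}_1$ be a finite tree with two distinct vertices $i_1,i_2$, and let $i_1=l_0\sim l_1\sim\dots\sim l_d=i_2$ be the path of $\mathcal{T}_1$ from $i_1$ to $i_2$, where $d\ge2$. Let $\mathcal{T}_2$ be formed from $\mathcal{T}_1$ by contracting the edge $\{l_0,l_1\}$ and subdividing the edge $\{l_{d-1},l_d\}$ (inserting one new vertex). For $0\le i\le d$, let $C_i$ be the component containing $l_i$ of the forest obtained from $\mathcal{T}_1$ by deleting all edges of the path $l_0\sim l_1\sim\dots\sim l_d$. Suppose that for some integer $t\ge2$, $$|V(C_0)|=|V(C_1)|=\dots=|V(C_{d-1})|=t\quad\text{and}\quad |V(C_d)|=t-1.$$ Then $\kappa(\mathcal{T}_1)=\kappa(\mathcal{T}_2)$; consequently, if $\mathcal{T}_1$ and $\mathcal{T}_2$ are non-isomorphic, they are co-Kemeny mates.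
   Context: Graphs are finite, simple and undirected; $u\sim v$ denotes that $u,v$ are adjacent. Let $G$ be a connected graph with vertex set $\{1,\dots,n\}$, $n\ge2$. Let $m_G$ be its number of edges, $\tau_G$ its number of spanning trees, and $\mathbf{d}_G$ the column vector whose $i$-th entry is the degree of vertex $i$. A 2-tree spanning forest of $G$ is a spanning subgraph that is a forest with exactly two connected components (trees). Let $f^G_{i,j}$ be the number of 2-tree spanning forests of $G$ in which one of the two trees contains $i$ and the other contains $j$ (so $f^G_{i,i}=0$), and let $F_G=[f^G_{i,j}]_{i,j=1}^n$. Kemeny's constant of (the random walk on) $G$ is $$\kappa(G)=\frac{\mathbf{d}_G^TF_G\mathbf{d}_G}{4m_G\tau_G}.$$ Two non-isomorphic connected graphs $G_1,G_2$ on the same number of vertices are called co-Kemeny mates if $\kappa(G_1)=\kappa(G_2)$. *)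

theory Defs
  imports Complex_Main
begin

text \<open>
  AFP Graph\_Theory represents undirected graphs as symmetric digraphs; there every edge is itself
  a directed 2-cycle and its \<open>spanning_tree\<close> ranges over oriented arc sets, so counting with it
  does not give the number of spanning trees of the undirected graph. Hence edges are
  two-element sets of vertices here.
\<close>

record 'a ugraph =
  verts :: "'a set"
  edges :: "'a set set"

definition is_graph :: "'a ugraph \<Rightarrow> bool" where
  "is_graph G \<longleftrightarrow> finite (verts G) \<and> (\<forall>e\<in>edges G. e \<subseteq> verts G \<and> card e = 2)"

definition adj :: "'a ugraph \<Rightarrow> 'a \<Rightarrow> 'a \<Rightarrow> bool" where
  "adj G u v \<longleftrightarrow> {u, v} \<in> edges G"

definition degree :: "'a ugraph \<Rightarrow> 'a \<Rightarrow> nat" where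
  "degree G v = card {u \<in> verts G. adj G v u}"

definition is_path :: "'a ugraph \<Rightarrow> 'a list \<Rightarrow> bool" where
  "is_path G p \<longleftrightarrow> p \<noteq> [] \<and> set p \<subseteq> verts G \<and> distinct p \<and> successively (adj G) p"

definition path_edges :: "'a list \<Rightarrow> 'a set set" where
  "path_edges p = {{p ! k, p ! Suc k} |k. Suc k < length p}"

definition is_cycle :: "'a ugraph \<Rightarrow> 'a list \<Rightarrow> bool" where
  "is_cycle G c \<longleftrightarrow> is_path G c \<and> 3 \<le> length c \<and> adj G (last c) (hd c)"

text \<open>Vertex sets of connected components.\<close>

definition component :: "'a ugraph \<Rightarrow> 'a \<Rightarrow> 'a set" where
  "component G v = {u \<in> verts G. \<exists>p. is_path G p \<and> hd p = v \<and> last p = u}"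

definition components :: "'a ugraph \<Rightarrow> 'a set set" where
  "components G = component G ` verts G"

definition is_connected :: "'a ugraph \<Rightarrow> bool" where
  "is_connected G \<longleftrightarrow> verts G \<noteq> {} \<and>
     (\<forall>u\<in>verts G. \<forall>v\<in>verts G. \<exists>p. is_path G p \<and> hd p = u \<and> last p = v)"

definition is_forest :: "'a ugraph \<Rightarrow> bool" where
  "is_forest G \<longleftrightarrow> is_graph G \<and> (\<nexists>c. is_cycle G c)"

definition is_tree :: "'a ugraph \<Rightarrow> bool" where
  "is_tree G \<longleftrightarrow> is_forest G \<and> is_connected G"

definition spanning_subgraph :: "'a ugraph \<Rightarrow> 'a ugraph \<Rightarrow> bool" where
  "spanning_subgraph H G \<longleftrightarrow> verts H = verts G \<and> edges H \<subseteq> edges G"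

definition num_spanning_trees :: "'a ugraph \<Rightarrow> nat" where
  "num_spanning_trees G = card {H. spanning_subgraph H G \<and> is_tree H}"

definition two_tree_spanning_forests :: "'a ugraph \<Rightarrow> 'a ugraph set" where
  "two_tree_spanning_forests G =
     {H. spanning_subgraph H G \<and> is_forest H \<and> card (components H) = 2}"

definition num_separating_forests :: "'a ugraph \<Rightarrow> 'a \<Rightarrow> 'a \<Rightarrow> nat" where
  "num_separating_forests G i j =
     card {H \<in> two_tree_spanning_forests G.
             \<exists>A\<in>components H. \<exists>B\<in>components H. A \<noteq> B \<and> i \<in> A \<and> j \<in> B}"

text \<open>The numerator is the quadratic form of the degree vector in the matrix of the numbers
  \<open>num_separating_forests G i j\<close>. The value is meant only for connected graphs
  with at least two vertices.\<close>

definition kemeny :: "'a ugraph \<Rightarrow> real" where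
  "kemeny G =
     (\<Sum>i\<in>verts G. \<Sum>j\<in>verts G.
        real (degree G i) * real (num_separating_forests G i j) * real (degree G j))
     / (4 * real (card (edges G)) * real (num_spanning_trees G))"

definition isomorphic :: "'a ugraph \<Rightarrow> 'b ugraph \<Rightarrow> bool" where
  "isomorphic G H \<longleftrightarrow> (\<exists>f. bij_betw f (verts G) (verts H) \<and>
     (\<forall>u\<in>verts G. \<forall>v\<in>verts G. adj G u v \<longleftrightarrow> adj H (f u) (f v)))"

definition co_kemeny_mates :: "'a ugraph \<Rightarrow> 'b ugraph \<Rightarrow> bool" where
  "co_kemeny_mates G H \<longleftrightarrow>
     is_graph G \<and> is_connected G \<and> is_graph H \<and> is_connected H \<and>
     card (verts G) = card (verts H) \<and> 2 \<le> card (verts G) \<and>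
     \<not> isomorphic G H \<and> kemeny G = kemeny H"

definition delete_edges :: "'a ugraph \<Rightarrow> 'a set set \<Rightarrow> 'a ugraph" where
  "delete_edges G F = \<lparr>verts = verts G, edges = edges G - F\<rparr>"

text \<open>The merged vertex keeps the name \<open>v\<close>; the condition on the cardinality discards the loop
  that arises from the contracted edge.\<close>

definition contract_edge :: "'a ugraph \<Rightarrow> 'a \<Rightarrow> 'a \<Rightarrow> 'a ugraph" where
  "contract_edge G u v =
     \<lparr>verts = verts G - {u},
      edges = {e \<in> (\<lambda>e. (\<lambda>x. if x = u then v else x) ` e) ` edges G. card e = 2}\<rparr>"

definition subdivide_edge :: "'a ugraph \<Rightarrow> 'a \<Rightarrow> 'a \<Rightarrow> 'a \<Rightarrow> 'a ugraph" where
  "subdivide_edge G u v w =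
     \<lparr>verts = insert w (verts G),
      edges = (edges G - {{u, v}}) \<union> {{u, w}, {w, v}}\<rparr>"

end

theory Submission
  imports Defs
begin

text \<open>
  In a tree the forests separating \<open>i\<close> from \<open>j\<close> are the edges on the path between them, so the
  numerator of Kemeny's constant is a sum over edges of products of the degree sums of the two
  sides. A side with \<open>a\<close> vertices has degree sum \<open>2 * a - 1\<close>; hence for trees of order \<open>n\<close>
  Kemeny's constant depends only on the sum over edges of \<open>a * (n - a)\<close>. Contracting the first and
  subdividing the last edge of the path keeps the side sizes of all edges off the path, and the
  hypothesis on the sizes of the \<open>C i\<close> makes it reverse the list of side sizes of the path edges.
\<close>

text \<open>The given notions of path, cycle and component speak of vertex lists, which do not
  survive the identification of two vertices. Hence a tree is treated here as a connected edge set
  all of whose edges are bridges, and a bridge is certified by a vertex set \<open>A\<close> that it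
  alone crosses. Such an \<open>A\<close> changes by at most one vertex under contraction or
  subdivision, and its cardinality is the side size that enters Kemeny's constant. The size
  \<open>t - 1\<close> of the last component is what makes the exchange work. In the old tree the
  path edge with index \<open>k\<close> has \<open>(k + 1) * t\<close> vertices on the near side and
  \<open>(d - k) * t - 1\<close> on the far side. Contraction takes a vertex from the near side and
  subdivision adds one to the far side, so the missing vertex changes sides; this is the same pair
  of sizes as for the index \<open>d - 1 - k\<close>, with the sides exchanged. At the far end one
  half of the subdivided edge inherits the sizes of the contracted edge, and the other half keeps
  those of the old last edge.\<close>

section \<open>Reachability along a set of edges\<close>

definition reach :: "'a set set \<Rightarrow> ('a \<times> 'a) set" where
  "reach E = {(x, y). {x, y} \<in> E}\<^sup>*"

lemma reach_refl [simp]: "(x, x) \<in> reach E"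
  by (simp add: reach_def)

lemma reach_edge: "{x, y} \<in> E \<Longrightarrow> (x, y) \<in> reach E"
  by (auto simp: reach_def)

lemma reach_trans: "(x, y) \<in> reach E \<Longrightarrow> (y, z) \<in> reach E \<Longrightarrow> (x, z) \<in> reach E"
  by (auto simp: reach_def)

lemma reach_sym: "(x, y) \<in> reach E \<Longrightarrow> (y, x) \<in> reach E"
proof -
  have "sym {(x, y). {x, y} \<in> E}"
    by (auto simp: sym_def insert_commute)
  then show "(x, y) \<in> reach E \<Longrightarrow> (y, x) \<in> reach E"
    unfolding reach_def by (metis sym_rtrancl symD)
qed

lemma reach_join: "(z, x) \<in> reach E \<Longrightarrow> (z, y) \<in> reach E \<Longrightarrow> (x, y) \<in> reach E"
  by (rule reach_trans[OF reach_sym])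

lemma reach_mono: "(x, y) \<in> reach E \<Longrightarrow> E \<subseteq> F \<Longrightarrow> (x, y) \<in> reach F"
  unfolding reach_def by (rule rtrancl_mono[THEN subsetD, rotated]) auto

lemma reach_induct [consumes 1, case_names refl step]:
  assumes "(x, y) \<in> reach E" "P x"
    and "\<And>y z. (x, y) \<in> reach E \<Longrightarrow> {y, z} \<in> E \<Longrightarrow> P y \<Longrightarrow> P z"
  shows "P y"
  using assms(1) unfolding reach_def
  by (induction rule: rtrancl_induct) (use assms(2,3) in \<open>auto simp: reach_def\<close>)

text \<open>A walk cannot leave a set that no edge crosses, and it then uses only edges inside the
  set. The first half shows that cuts separate, the second that the sides of a cut are
  connected.\<close>

lemma reach_within:
  assumes "(x, y) \<in> reach E" "x \<in> A" "\<And>f. f \<in> E \<Longrightarrow> f \<inter> A = {} \<or> f \<subseteq> A"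
  shows "y \<in> A \<and> (x, y) \<in> reach {f \<in> E. f \<subseteq> A}"
  using assms(1)
proof (induction rule: reach_induct)
  case refl
  then show ?case using assms(2) by simp
next
  case (step y z)
  then have "{y, z} \<subseteq> A" using assms(3)[of "{y, z}"] by auto
  then show ?case using step by (auto intro: reach_trans reach_edge)
qed

text \<open>Edges need only map to reachable pairs: contraction collapses an edge to a point, and
  subdivision replaces one by a walk of length two.\<close>

lemma reach_map:
  assumes "(x, y) \<in> reach E" "\<And>x y. {x, y} \<in> E \<Longrightarrow> (h x, h y) \<in> reach F"
  shows "(h x, h y) \<in> reach F"
  using assms(1) by (induction rule: reach_induct) (auto intro: reach_trans assms(2))

section \<open>Trees and cuts\<close>

definition tree_on :: "'a set \<Rightarrow> 'a set set \<Rightarrow> bool" where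
  "tree_on V E \<longleftrightarrow> finite V \<and> (\<forall>e\<in>E. e \<subseteq> V \<and> card e = 2) \<and>
     (\<forall>x\<in>V. \<forall>y\<in>V. (x, y) \<in> reach E) \<and>
     (\<forall>x y. {x, y} \<in> E \<longrightarrow> (x, y) \<notin> reach (E - {{x, y}}))"

lemma tree_onD:
  assumes "tree_on V E"
  shows "finite V" "finite E" "e \<in> E \<Longrightarrow> e \<subseteq> V" "e \<in> E \<Longrightarrow> card e = 2"
    "x \<in> V \<Longrightarrow> y \<in> V \<Longrightarrow> (x, y) \<in> reach E"
    "{x, y} \<in> E \<Longrightarrow> (x, y) \<notin> reach (E - {{x, y}})"
proof -
  have "E \<subseteq> Pow V" "finite V" using assms unfolding tree_on_def by auto
  then show "finite E" by (meson finite_Pow_iff finite_subset)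
qed (use assms in \<open>auto simp: tree_on_def\<close>)

definition crosses :: "'a set \<Rightarrow> 'a set \<Rightarrow> bool" where
  "crosses f A \<longleftrightarrow> f \<inter> A \<noteq> {} \<and> \<not> f \<subseteq> A"

lemma crosses_pair [simp]: "crosses {x, y} A \<longleftrightarrow> (x \<in> A) \<noteq> (y \<in> A)"
  by (auto simp: crosses_def)

text \<open>The fundamental cut of the tree edge \<open>e\<close>, with \<open>A\<close> as one of
  its two sides. No walk occurs in it, so it can be checked edge by edge.\<close>

definition is_cut :: "'a set \<Rightarrow> 'a set set \<Rightarrow> 'a set \<Rightarrow> 'a set \<Rightarrow> bool" where
  "is_cut V E e A \<longleftrightarrow> A \<subseteq> V \<and> e \<in> E \<and> (\<forall>f\<in>E. crosses f A \<longleftrightarrow> f = e)"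

lemma is_cut_same_side:
  assumes "is_cut V E e A" "{x, y} \<in> E" "{x, y} \<noteq> e"
  shows "x \<in> A \<longleftrightarrow> y \<in> A"
proof -
  have "crosses {x, y} A \<longleftrightarrow> {x, y} = e" using assms(1,2) by (simp add: is_cut_def del: crosses_pair)
  then show ?thesis using assms(3) by simp
qed

lemma is_cut_not_reach:
  assumes "is_cut V E e A" "x \<in> A" "y \<notin> A"
  shows "(x, y) \<notin> reach (E - {e})"
proof
  assume "(x, y) \<in> reach (E - {e})"
  then have "y \<in> A" using assms reach_within[of x y "E - {e}" A]
    by (auto simp: is_cut_def crosses_def)
  then show False using assms by simp
qed

text \<open>After its last passage through the removed edge a walk continues from \<open>u\<close>
  or from \<open>v\<close>.\<close>

lemma reach_remove_edge:
  assumes "(u, x) \<in> reach E"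
  shows "(u, x) \<in> reach (E - {{u, v}}) \<or> (v, x) \<in> reach (E - {{u, v}})"
  using assms
proof (induction rule: reach_induct)
  case refl
  then show ?case by simp
next
  case (step y z)
  show ?case
  proof (cases "{y, z} = {u, v}")
    case True
    then have "z = u \<or> z = v" by (auto simp: doubleton_eq_iff)
    then show ?thesis by auto
  next
    case False
    then have "(y, z) \<in> reach (E - {{u, v}})" using step by (intro reach_edge) auto
    then show ?thesis using step reach_trans by metis
  qed
qed

lemma tree_on_edgeE:
  assumes "tree_on V E" "e \<in> E"
  obtains u v where "e = {u, v}" "u \<noteq> v" "u \<in> V" "v \<in> V"
proof -
  have "card e = 2" "e \<subseteq> V" using tree_onD[OF assms(1)] assms(2) by auto
  then obtain u v where "e = {u, v}" "u \<noteq> v" by (auto simp: card_2_iff)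
  then show thesis using that \<open>e \<subseteq> V\<close> by auto
qed

lemma tree_on_reach_end:
  assumes "tree_on V E" "{u, v} \<in> E" "x \<in> V"
  shows "(u, x) \<in> reach (E - {{u, v}}) \<or> (v, x) \<in> reach (E - {{u, v}})"
  using assms tree_onD(3,5)[OF assms(1)] by (intro reach_remove_edge) auto

text \<open>The root \<open>r\<close> selects the side: \<open>A\<close> is the side of
  \<open>e\<close> away from \<open>r\<close>. Exactly one end of \<open>e\<close> lies in it
  because \<open>e\<close> is a bridge and \<open>r\<close> still reaches one of its ends.\<close>

lemma tree_on_cut_exists:
  assumes "tree_on V E" "e \<in> E" "r \<in> V"
  shows "is_cut V E e {x \<in> V. (r, x) \<notin> reach (E - {e})}"
proof -
  let ?A = "{x \<in> V. (r, x) \<notin> reach (E - {e})}"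
  have "crosses f ?A \<longleftrightarrow> f = e" if fE: "f \<in> E" for f
  proof -
    obtain u v where uv: "f = {u, v}" "u \<in> V" "v \<in> V" "u \<noteq> v"
      using tree_on_edgeE[OF assms(1) fE] by metis
    show ?thesis
    proof (cases "f = e")
      case True
      have "(u, v) \<notin> reach (E - {e})" using tree_onD(6)[OF assms(1)] fE uv True by auto
      moreover have "(u, r) \<in> reach (E - {e}) \<or> (v, r) \<in> reach (E - {e})"
        using tree_on_reach_end[OF assms(1)] uv True assms by auto
      ultimately show ?thesis using uv True by simp (metis reach_sym reach_trans)
    next
      case False
      then have "(u, v) \<in> reach (E - {e})" using uv fE by (intro reach_edge) auto
      then show ?thesis using uv False by simp (metis reach_sym reach_trans)
    qed
  qed
  then show ?thesis using assms(2) by (auto simp: is_cut_def)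
qed

lemma is_cut_reach_iff:
  assumes "tree_on V E" "is_cut V E e A" "x \<in> V" "y \<in> V"
  shows "(x, y) \<in> reach (E - {e}) \<longleftrightarrow> (x \<in> A \<longleftrightarrow> y \<in> A)"
proof
  assume "(x, y) \<in> reach (E - {e})"
  then show "x \<in> A \<longleftrightarrow> y \<in> A"
    using is_cut_not_reach[OF assms(2)] reach_sym by metis
next
  assume same: "x \<in> A \<longleftrightarrow> y \<in> A"
  have e: "e \<in> E" using assms(2) by (simp add: is_cut_def)
  obtain u v where uv: "e = {u, v}" using tree_on_edgeE[OF assms(1) e] .
  have "crosses e A" using assms(2) by (auto simp: is_cut_def)
  then have cr: "(u \<in> A) \<noteq> (v \<in> A)" using uv by simp
  \<comment> \<open>Without \<open>e\<close>, every vertex is still reached from an end of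
    \<open>e\<close>, and that end lies on the same side. Since each side contains only one end, two
    vertices of one side share it.\<close>
  have rep: "\<exists>a\<in>{u, v}. (a, z) \<in> reach (E - {e}) \<and> (a \<in> A \<longleftrightarrow> z \<in> A)" if zV: "z \<in> V" for z
  proof -
    obtain a where a: "a \<in> {u, v}" "(a, z) \<in> reach (E - {e})"
      using tree_on_reach_end[OF assms(1) e[unfolded uv] zV] uv by blast
    then show ?thesis
      using is_cut_not_reach[OF assms(2)] reach_sym[OF a(2)] by blast
  qed
  obtain a b where "a \<in> {u, v}" "(a, x) \<in> reach (E - {e})" "a \<in> A \<longleftrightarrow> x \<in> A"
    "b \<in> {u, v}" "(b, y) \<in> reach (E - {e})" "b \<in> A \<longleftrightarrow> y \<in> A"
    using rep[OF assms(3)] rep[OF assms(4)] by blast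
  moreover from this have "a = b" using same cr by auto
  ultimately show "(x, y) \<in> reach (E - {e})" using reach_sym reach_trans by metis
qed

text \<open>A set crossed by \<open>e\<close> alone proves \<open>e\<close> to be a bridge; this is
  how contraction and subdivision are shown to yield trees.\<close>

lemma tree_onI_cuts:
  assumes "finite V" "\<And>e. e \<in> E \<Longrightarrow> e \<subseteq> V \<and> card e = 2"
    and "\<And>x y. x \<in> V \<Longrightarrow> y \<in> V \<Longrightarrow> (x, y) \<in> reach E"
    and "\<And>e. e \<in> E \<Longrightarrow> \<exists>A. is_cut V E e A"
  shows "tree_on V E"
proof -
  have "(x, y) \<notin> reach (E - {{x, y}})" if xy: "{x, y} \<in> E" for x y
  proof -
    obtain A where A: "is_cut V E {x, y} A" using assms(4)[OF xy] by blast
    then have "crosses {x, y} A" by (simp add: is_cut_def del: crosses_pair)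
    then have "(x \<in> A) \<noteq> (y \<in> A)" by simp
    then show ?thesis using is_cut_not_reach[OF A] reach_sym by metis
  qed
  then show ?thesis using assms by (auto simp: tree_on_def)
qed

lemma is_cut_subtree:
  assumes "tree_on V E" "is_cut V E e A"
  shows "tree_on A {f \<in> E. f \<subseteq> A}"
  unfolding tree_on_def
proof (intro conjI ballI allI impI)
  have AV: "A \<subseteq> V" using assms(2) by (simp add: is_cut_def)
  then show "finite A" using tree_onD(1)[OF assms(1)] finite_subset by blast
  fix f assume "f \<in> {f \<in> E. f \<subseteq> A}"
  then show "f \<subseteq> A" "card f = 2" using tree_onD(4)[OF assms(1)] by auto
next
  fix x y assume xy: "x \<in> A" "y \<in> A"
  have "A \<subseteq> V" using assms(2) by (simp add: is_cut_def)
  then have "(x, y) \<in> reach (E - {e})" using is_cut_reach_iff[OF assms] xy by blast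
  then have "(x, y) \<in> reach {f \<in> E - {e}. f \<subseteq> A}"
    using reach_within[of x y "E - {e}" A] xy assms(2) by (auto simp: is_cut_def crosses_def)
  then show "(x, y) \<in> reach {f \<in> E. f \<subseteq> A}" by (rule reach_mono) auto
next
  fix x y assume "{x, y} \<in> {f \<in> E. f \<subseteq> A}"
  then have "(x, y) \<notin> reach (E - {{x, y}})" using tree_onD(6)[OF assms(1)] by auto
  then show "(x, y) \<notin> reach ({f \<in> E. f \<subseteq> A} - {{x, y}})" 
    using reach_mono[of x y "{f \<in> E. f \<subseteq> A} - {{x, y}}" "E - {{x, y}}"] by blast
qed

lemma is_cut_compl:
  assumes "tree_on V E" "is_cut V E e A"
  shows "is_cut V E e (V - A)"
proof -
  have "crosses f (V - A) \<longleftrightarrow> crosses f A" if "f \<in> E" for f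
    using tree_onD(3)[OF assms(1) that] by (auto simp: crosses_def)
  then show ?thesis using assms(2) by (auto simp: is_cut_def)
qed

lemma is_cut_psubset:
  assumes "tree_on V E" "is_cut V E e A"
  shows "A \<subset> V" "A \<noteq> {}"
proof -
  have "e \<in> E" "A \<subseteq> V" "crosses e A" using assms(2) by (auto simp: is_cut_def)
  then show "A \<subset> V" "A \<noteq> {}" using tree_onD(3)[OF assms(1)] by (auto simp: crosses_def)
qed

text \<open>Strong induction on the order: removing an edge leaves its two sides as smaller trees,
  and every other edge lies within one of them.\<close>

lemma card_edges_tree_on:
  assumes "tree_on V E" "V \<noteq> {}"
  shows "card E + 1 = card V"
  using assms
proof (induction "card V" arbitrary: V E rule: less_induct)
  case less
  note T = less.prems(1)
  have fin: "finite V" "finite E" using tree_onD(1,2)[OF T] .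
  show ?case
  proof (cases "E = {}")
    case True
    have "{(x, y). {x, y} \<in> {}} = {}" by simp
    then have "reach ({} :: 'a set set) = Id" by (simp add: reach_def)
    then have "\<forall>x\<in>V. \<forall>y\<in>V. x = y" using tree_onD(5)[OF T] True by auto
    then obtain x where "V = {x}" using less.prems(2) by blast
    then show ?thesis using True by simp
  next
    case False
    then obtain e r where e: "e \<in> E" and r: "r \<in> V" using less.prems(2) by blast
    define A where "A = {x \<in> V. (r, x) \<notin> reach (E - {e})}"
    have cA: "is_cut V E e A" unfolding A_def by (rule tree_on_cut_exists[OF T e r])
    have cB: "is_cut V E e (V - A)" by (rule is_cut_compl[OF T cA])
    let ?EA = "{f \<in> E. f \<subseteq> A}" and ?EB = "{f \<in> E. f \<subseteq> V - A}"
    have A: "A \<subset> V" "A \<noteq> {}" using is_cut_psubset[OF T cA] .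
    have "card A < card V" using fin A psubset_card_mono by blast
    then have cA': "card ?EA + 1 = card A"
      using less.hyps is_cut_subtree[OF T cA] A(2) by blast
    have "V - A \<subset> V" "V - A \<noteq> {}" using is_cut_psubset[OF T cB] .
    then have cB': "card ?EB + 1 = card (V - A)"
      using less.hyps is_cut_subtree[OF T cB] psubset_card_mono[OF fin(1)] by blast
    have Ev: "f \<subseteq> V \<and> f \<noteq> {}" if "f \<in> E" for f
      using tree_onD(3,4)[OF T that] by auto
    have Eeq: "E = insert e (?EA \<union> ?EB)"
      using cA Ev by (auto simp: is_cut_def crosses_def)
    have "e \<notin> ?EA \<union> ?EB"
      using cA Ev by (auto simp: is_cut_def crosses_def)
    moreover have "?EA \<inter> ?EB = {}" using Ev by blast
    moreover have "finite ?EA" "finite ?EB" using fin(2) by auto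
    ultimately have "card (insert e (?EA \<union> ?EB)) = Suc (card ?EA + card ?EB)"
      by (simp only: card_insert_disjoint card_Un_disjoint finite_Un simp_thms)
    then have "card E = Suc (card ?EA + card ?EB)"
      by (subst Eeq)
    moreover have "card (V - A) + card A = card V" using A fin(1)
      by (metis card_Diff_subset card_mono finite_subset le_add_diff_inverse2 psubset_eq)
    ultimately show ?thesis using cA' cB' by simp
  qed
qed

section \<open>Edge weights and degree sums\<close>

text \<open>Counting separated ordered pairs avoids choosing a side of the cut; the value is twice
  the product of the side sizes.\<close>

definition edge_weight :: "'a set \<Rightarrow> 'a set set \<Rightarrow> 'a set \<Rightarrow> nat" where
  "edge_weight V E e = card {(i, j) \<in> V \<times> V. (i, j) \<notin> reach (E - {e})}"

lemma is_cut_separated_pairs: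
  assumes "tree_on V E" "is_cut V E e A"
  shows "{(i, j) \<in> V \<times> V. (i, j) \<notin> reach (E - {e})} = A \<times> (V - A) \<union> (V - A) \<times> A"
  using is_cut_reach_iff[OF assms] assms(2) by (auto simp: is_cut_def)

lemma edge_weight_cut:
  assumes "tree_on V E" "is_cut V E e A"
  shows "edge_weight V E e = 2 * card A * card (V - A)"
proof -
  have "finite A" "finite V"
    using assms by (auto simp: is_cut_def tree_on_def intro: finite_subset)
  then have "card (A \<times> (V - A) \<union> (V - A) \<times> A) = 2 * card A * card (V - A)"
    by (subst card_Un_disjoint) (auto simp: card_cartesian_product)
  then show ?thesis unfolding edge_weight_def is_cut_separated_pairs[OF assms] .
qed

lemma degree_eq_incident:
  assumes "is_graph G"
  shows "degree G v = card {e \<in> edges G. v \<in> e}"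
proof -
  have "{e \<in> edges G. v \<in> e} = (\<lambda>u. {v, u}) ` {u \<in> verts G. adj G v u}"
  proof (intro equalityI subsetI)
    fix e assume "e \<in> {e \<in> edges G. v \<in> e}"
    moreover from this have "card e = 2" "e \<subseteq> verts G" using assms by (auto simp: is_graph_def)
    ultimately show "e \<in> (\<lambda>u. {v, u}) ` {u \<in> verts G. adj G v u}"
      by (auto simp: card_2_iff adj_def insert_commute)
  qed (auto simp: adj_def)
  moreover have "inj_on (\<lambda>u. {v, u}) {u \<in> verts G. adj G v u}"
    by (auto simp: inj_on_def doubleton_eq_iff)
  ultimately show ?thesis by (simp add: degree_def card_image)
qed

text \<open>Double counting of incidences with \<open>A\<close>: each of the
  \<open>card A - 1\<close> edges inside \<open>A\<close> counts twice, and \<open>e\<close> counts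
  once.\<close>

lemma sum_degree_cut:
  assumes "is_graph G" "tree_on (verts G) (edges G)" "is_cut (verts G) (edges G) e A"
  shows "(\<Sum>x\<in>A. degree G x) + 1 = 2 * card A"
proof -
  let ?E = "edges G" and ?F = "{f \<in> edges G. f \<subseteq> A}"
  have fin: "finite ?E" "finite A" "finite (verts G)"
    using tree_onD(1,2)[OF assms(2)] assms(3) by (auto simp: is_cut_def intro: finite_subset)
  have e: "e \<in> ?E" using assms(3) by (simp add: is_cut_def)
  have "(\<Sum>x\<in>A. degree G x) = (\<Sum>x\<in>A. \<Sum>f\<in>?E. if x \<in> f then 1 else 0)"
    by (simp add: degree_eq_incident[OF assms(1)] sum.If_cases fin Int_def)
  also have "\<dots> = (\<Sum>f\<in>?E. \<Sum>x\<in>A. if x \<in> f then 1 else 0)"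
    by (rule sum.swap)
  also have "\<dots> = (\<Sum>f\<in>?E. card (A \<inter> f))"
    by (simp add: sum.If_cases fin)
  also have "\<dots> = (\<Sum>f\<in>insert e ?F. card (A \<inter> f))"
    using assms(3) fin by (intro sum.mono_neutral_right) (auto simp: is_cut_def crosses_def)
  also have "\<dots> = card (A \<inter> e) + (\<Sum>f\<in>?F. card (A \<inter> f))"
    using fin assms(3) by (subst sum.insert) (auto simp: is_cut_def crosses_def)
  also have "(\<Sum>f\<in>?F. card (A \<inter> f)) = (\<Sum>f\<in>?F. 2)"
    using tree_onD(4)[OF assms(2)] by (intro sum.cong) (auto simp: Int_absorb1)
  also have "card (A \<inter> e) = 1"
  proof -
    obtain u v where uv: "e = {u, v}" using tree_on_edgeE[OF assms(2) e] .
    have "crosses e A" using assms(3) by (auto simp: is_cut_def)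
    then have "A \<inter> e = {u} \<or> A \<inter> e = {v}" using uv by auto
    then show ?thesis by auto
  qed
  finally have "(\<Sum>x\<in>A. degree G x) = 1 + 2 * card ?F" by simp
  moreover have "card ?F + 1 = card A"
    using card_edges_tree_on[OF is_cut_subtree[OF assms(2,3)]] is_cut_psubset[OF assms(2,3)] by simp
  ultimately show ?thesis by simp
qed


section \<open>Kemeny's constant of a tree\<close>

lemma reach_nth:
  "(p ! i, p ! (i + n)) \<in> reach ((\<lambda>k. {p ! k, p ! Suc k}) ` {i..<i + n})"
proof (induction n)
  case (Suc n)
  have "(p ! i, p ! (i + n)) \<in> reach ((\<lambda>k. {p ! k, p ! Suc k}) ` {i..<i + Suc n})"
    by (rule reach_mono[OF Suc.IH]) auto
  then show ?case
    by (rule reach_trans) (auto intro!: reach_edge)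
qed simp

lemma reach_path_edges:
  assumes "p \<noteq> []"
  shows "(hd p, last p) \<in> reach (path_edges p)"
proof -
  have "(p ! 0, p ! (0 + (length p - 1))) \<in> reach (path_edges p)"
    by (rule reach_mono[OF reach_nth]) (auto simp: path_edges_def)
  then show ?thesis using assms by (simp add: hd_conv_nth last_conv_nth)
qed

lemma path_edges_subset: "is_path G p \<Longrightarrow> path_edges p \<subseteq> edges G"
  by (auto simp: is_path_def path_edges_def successively_conv_nth adj_def)

text \<open>A walk is made simple as it grows: a step back to a vertex already on the path truncates
  the path at that vertex.\<close>

lemma path_exists_iff_reach:
  assumes "is_graph G"
  shows "(\<exists>p. is_path G p \<and> hd p = u \<and> last p = v) \<longleftrightarrow>
    u \<in> verts G \<and> v \<in> verts G \<and> (u, v) \<in> reach (edges G)"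
proof
  assume "\<exists>p. is_path G p \<and> hd p = u \<and> last p = v"
  then obtain p where p: "is_path G p" "hd p = u" "last p = v" by blast
  then have "p \<noteq> []" "set p \<subseteq> verts G" by (auto simp: is_path_def)
  then show "u \<in> verts G \<and> v \<in> verts G \<and> (u, v) \<in> reach (edges G)"
    using p reach_mono[OF reach_path_edges path_edges_subset, of p G] by auto
next
  assume "u \<in> verts G \<and> v \<in> verts G \<and> (u, v) \<in> reach (edges G)"
  then have u: "u \<in> verts G" and "(u, v) \<in> reach (edges G)" by auto
  from this(2) show "\<exists>p. is_path G p \<and> hd p = u \<and> last p = v"
  proof (induction rule: reach_induct)
    case refl
    show ?case using u by (intro exI[of _ "[u]"]) (auto simp: is_path_def)
  next
    case (step y z)
    then obtain p where p: "is_path G p" "hd p = u" "last p = y" by blast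
    have z: "z \<in> verts G" "adj G y z"
      using step(2) assms by (auto simp: is_graph_def adj_def)
    show ?case
    proof (cases "z \<in> set p")
      case True
      then obtain q r where q: "p = (q @ [z]) @ r" by (auto dest: split_list)
      then have "is_path G (q @ [z])"
        using p(1) by (auto simp: is_path_def successively_append_iff)
      moreover have "hd (q @ [z]) = u" using p(2) q by (cases q) auto
      ultimately show ?thesis by (intro exI[of _ "q @ [z]"]) simp
    next
      case False
      then show ?thesis using p z
        by (intro exI[of _ "p @ [z]"]) (auto simp: is_path_def successively_append_iff)
    qed
  qed
qed

lemma component_eq_reach:
  "is_graph G \<Longrightarrow> v \<in> verts G \<Longrightarrow> component G v = {u \<in> verts G. (v, u) \<in> reach (edges G)}"
  by (auto simp: component_def path_exists_iff_reach)

lemma closing_edge_notin_path_edges: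
  assumes "distinct c" "3 \<le> length c"
  shows "{last c, hd c} \<notin> path_edges c"
proof
  assume "{last c, hd c} \<in> path_edges c"
  moreover have "c \<noteq> []" using assms by auto
  ultimately obtain k where "Suc k < length c" "{c ! (length c - 1), c ! 0} = {c ! k, c ! Suc k}"
    by (auto simp: path_edges_def last_conv_nth hd_conv_nth)
  moreover have "0 < length c" "length c - 1 < length c" using assms(2) by linarith+
  ultimately show False using assms
    by (auto simp: doubleton_eq_iff nth_eq_iff_index_eq Suc_lessD)
qed

text \<open>A cycle is an edge together with a detour between its ends that avoids it.\<close>

lemma is_forest_iff_bridges:
  "is_forest G \<longleftrightarrow> is_graph G \<and>
     (\<forall>x y. {x, y} \<in> edges G \<longrightarrow> (x, y) \<notin> reach (edges G - {{x, y}}))"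
proof -
  have "\<exists>x y. {x, y} \<in> edges G \<and> (x, y) \<in> reach (edges G - {{x, y}})" if "is_cycle G c" for c
  proof -
    have c: "is_path G c" "3 \<le> length c" "{last c, hd c} \<in> edges G" "distinct c" "c \<noteq> []"
      using that by (auto simp: is_cycle_def adj_def is_path_def)
    have "path_edges c \<subseteq> edges G - {{last c, hd c}}"
      using closing_edge_notin_path_edges[OF c(4,2)] path_edges_subset[OF c(1)] by blast
    then show ?thesis using c reach_sym[OF reach_mono[OF reach_path_edges]] by blast
  qed
  moreover have "\<exists>c. is_cycle G c"
    if G: "is_graph G" and xy: "{x, y} \<in> edges G" "(x, y) \<in> reach (edges G - {{x, y}})" for x y
  proof -
    let ?H = "\<lparr>verts = verts G, edges = edges G - {{x, y}}\<rparr>"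
    have "is_graph ?H" using G by (auto simp: is_graph_def)
    moreover have "x \<in> verts G" "y \<in> verts G" "x \<noteq> y"
      using xy(1) G by (auto simp: is_graph_def)
    ultimately obtain p where p: "is_path ?H p" "hd p = x" "last p = y"
      using path_exists_iff_reach[of ?H x y] xy(2) by auto
    \<comment> \<open>A path on at most two vertices between distinct \<open>x\<close> and
      \<open>y\<close> would use the deleted edge.\<close>
    have "3 \<le> length p"
    proof (rule ccontr)
      assume "\<not> 3 \<le> length p"
      then consider "p = []" | a where "p = [a]" | a b where "p = [a, b]"
        by (cases p; cases "tl p"; cases "tl (tl p)") auto
      then show False using p \<open>x \<noteq> y\<close> by cases (auto simp: is_path_def adj_def)
    qed
    moreover have "is_path G p"
      using p(1) unfolding is_path_def by (auto simp: adj_def elim: successively_mono)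
    ultimately show ?thesis using p xy(1)
      by (auto simp: is_cycle_def adj_def insert_commute)
  qed
  ultimately show ?thesis unfolding is_forest_def by blast
qed

lemma is_tree_iff_tree_on: "is_tree G \<longleftrightarrow> tree_on (verts G) (edges G) \<and> verts G \<noteq> {}"
proof (cases "is_graph G")
  case True
  then show ?thesis
    by (auto simp: is_tree_def is_forest_iff_bridges is_connected_def path_exists_iff_reach
        tree_on_def is_graph_def)
next
  case False
  then show ?thesis by (auto simp: is_tree_def is_forest_def tree_on_def is_graph_def)
qed

section \<open>Spanning trees and two-tree forests of a tree\<close>

lemma num_spanning_trees_tree:
  assumes "is_tree T"
  shows "num_spanning_trees T = 1"
proof -
  have T: "tree_on (verts T) (edges T)" using assms is_tree_iff_tree_on by blast
  have "H = T" if H: "spanning_subgraph H T" "is_tree H" for H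
  proof -
    have HT: "tree_on (verts T) (edges H)" "edges H \<subseteq> edges T" "verts H = verts T"
      using H by (auto simp: is_tree_iff_tree_on spanning_subgraph_def)
    have "edges T \<subseteq> edges H"
    proof (rule ccontr)
      assume "\<not> edges T \<subseteq> edges H"
      then obtain e where e: "e \<in> edges T" "e \<notin> edges H" by blast
      obtain u v where uv: "e = {u, v}" "u \<in> verts T" "v \<in> verts T"
        using tree_on_edgeE[OF T e(1)] by metis
      have "(u, v) \<in> reach (edges T - {e})"
        by (rule reach_mono[OF tree_onD(5)[OF HT(1) uv(2,3)]]) (use HT e in auto)
      then show False using tree_onD(6)[OF T] e uv by auto
    qed
    then show ?thesis using HT by (intro ugraph.equality) auto
  qed
  then have "{H. spanning_subgraph H T \<and> is_tree H} = {T}"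
    using assms by (auto simp: spanning_subgraph_def)
  then show ?thesis by (simp add: num_spanning_trees_def)
qed

lemma component_delete_edges:
  assumes "is_graph G" "v \<in> verts G"
  shows "component (delete_edges G F) v = {u \<in> verts G. (v, u) \<in> reach (edges G - F)}"
proof -
  have "is_graph (delete_edges G F)" using assms(1) by (auto simp: is_graph_def delete_edges_def)
  then show ?thesis using component_eq_reach assms(2) by (fastforce simp: delete_edges_def)
qed

lemma components_eq_iff:
  assumes "is_graph G" "x \<in> verts G" "y \<in> verts G"
  shows "component G x = component G y \<longleftrightarrow> (x, y) \<in> reach (edges G)"
  using assms by (auto simp: component_eq_reach intro: reach_trans reach_sym)

text \<open>The number of missing edges decides: none leaves one component, one leaves two, and two
  or more leave at least three.\<close>

lemma two_tree_spanning_forests_tree: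
  assumes "is_tree T"
  shows "two_tree_spanning_forests T = (\<lambda>e. delete_edges T {e}) ` edges T"
proof (intro equalityI subsetI)
  have T: "tree_on (verts T) (edges T)" and ne: "verts T \<noteq> {}" and G: "is_graph T"
    using assms is_tree_iff_tree_on by (auto simp: is_tree_def is_forest_def)
  {
    fix H assume "H \<in> two_tree_spanning_forests T"
    then have H: "verts H = verts T" "edges H \<subseteq> edges T" "card (components H) = 2" "is_graph H"
      by (auto simp: two_tree_spanning_forests_def spanning_subgraph_def is_forest_def)
    have "edges H \<noteq> edges T"
    proof
      assume "edges H = edges T"
      then have "component H ` verts H \<subseteq> {verts T}"
        using H tree_onD(5)[OF T] by (auto simp: component_eq_reach)
      then show False using H(3) card_mono[of "{verts T}" "component H ` verts H"]
        by (simp add: components_def)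
    qed
    then obtain e where e: "e \<in> edges T" "e \<notin> edges H" using H(2) by blast
    have "f = e" if f: "f \<in> edges T" "f \<notin> edges H" for f
    proof (rule ccontr)
      assume "f \<noteq> e"
      obtain x y where xy: "f = {x, y}" "x \<in> verts T" "y \<in> verts T"
        using tree_on_edgeE[OF T f(1)] by metis
      \<comment> \<open>The ends \<open>x\<close> and \<open>y\<close> of the second missing edge
        \<open>f\<close> lie on the same side of \<open>e\<close>; with any vertex \<open>v\<close>
        beyond \<open>e\<close> they represent three distinct components of
        \<open>H\<close>.\<close>
      define A where "A = {z \<in> verts T. (x, z) \<notin> reach (edges T - {e})}"
      have cut: "is_cut (verts T) (edges T) e A"
        unfolding A_def by (rule tree_on_cut_exists[OF T e(1) xy(2)])
      then obtain v where v: "v \<in> A" using is_cut_psubset[OF T cut] by blast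
      have "x \<notin> A" by (simp add: A_def)
      moreover have "y \<notin> A"
        using cut f(1) \<open>f \<noteq> e\<close> \<open>x \<notin> A\<close> xy(1) by (auto simp: is_cut_def)
      moreover have sub: "edges H \<subseteq> edges T - {e}" "edges H \<subseteq> edges T - {f}" using H(2) e f by auto
      ultimately have "(v, x) \<notin> reach (edges H)" "(v, y) \<notin> reach (edges H)"
        using is_cut_not_reach[OF cut v] reach_mono[OF _ sub(1)] by blast+
      moreover have "(x, y) \<notin> reach (edges H)"
        using tree_onD(6)[OF T, of x y] f(1) xy(1) reach_mono[OF _ sub(2)] by blast
      moreover have "v \<in> verts T" using v by (simp add: A_def)
      ultimately have "card {component H v, component H x, component H y} = 3"
        using xy H by (simp add: components_eq_iff)
      moreover have "card {component H v, component H x, component H y} \<le> card (components H)"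
        unfolding components_def using H(1) xy \<open>v \<in> verts T\<close> tree_onD(1)[OF T]
        by (intro card_mono) auto
      ultimately show False using H(3) by simp
    qed
    then have "edges H = edges T - {e}" using H(2) e by blast
    then have "H = delete_edges T {e}" using H(1) by (simp add: delete_edges_def)
    then show "H \<in> (\<lambda>e. delete_edges T {e}) ` edges T" using e by blast
  }
  {
    fix H assume "H \<in> (\<lambda>e. delete_edges T {e}) ` edges T"
    then obtain e where e: "e \<in> edges T" "H = delete_edges T {e}" by blast
    obtain u v where uv: "e = {u, v}" "u \<in> verts T" "v \<in> verts T"
      using tree_on_edgeE[OF T e(1)] by metis
    have H: "verts H = verts T" "edges H = edges T - {e}" using e by (auto simp: delete_edges_def)
    have GH: "is_graph H" using G H by (auto simp: is_graph_def)
    have "(x, y) \<notin> reach (edges H - {{x, y}})" if "{x, y} \<in> edges H" for x y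
      using tree_onD(6)[OF T, of x y] that H
        reach_mono[of x y "edges H - {{x, y}}" "edges T - {{x, y}}"] by blast
    then have "is_forest H" using GH by (simp add: is_forest_iff_bridges)
    moreover have "spanning_subgraph H T" using H by (auto simp: spanning_subgraph_def)
    moreover have "components H = {component H u, component H v}"
    proof -
      have "component H z \<in> {component H u, component H v}" if "z \<in> verts T" for z
        using tree_on_reach_end[OF T _ that, of u v] e uv that H GH
        by (auto simp: components_eq_iff dest: reach_sym)
      then show ?thesis using H uv by (auto simp: components_def)
    qed
    moreover have "component H u \<noteq> component H v"
      using tree_onD(6)[OF T, of u v] e uv H GH by (simp add: components_eq_iff)
    ultimately show "H \<in> two_tree_spanning_forests T"
      by (simp add: two_tree_spanning_forests_def)
  }
qed

lemma num_separating_forests_tree: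
  assumes "is_tree T" "i \<in> verts T" "j \<in> verts T"
  shows "num_separating_forests T i j = card {e \<in> edges T. (i, j) \<notin> reach (edges T - {e})}"
proof -
  have G: "is_graph T" using assms by (auto simp: is_tree_def is_forest_def)
  have sep: "(\<exists>A\<in>components H. \<exists>B\<in>components H. A \<noteq> B \<and> i \<in> A \<and> j \<in> B) \<longleftrightarrow>
      (i, j) \<notin> reach (edges T - {e})" if H: "H = delete_edges T {e}" for H e
  proof -
    have H': "verts H = verts T" "edges H = edges T - {e}" using H by (auto simp: delete_edges_def)
    then have GH: "is_graph H" using G by (auto simp: is_graph_def)
    have in_comp: "z \<in> A \<longleftrightarrow> A = component H z" if "A \<in> components H" "z \<in> verts T" for A z
    proof -
      obtain x where "x \<in> verts H" "A = component H x" using \<open>A \<in> components H\<close> by (auto simp: components_def)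
      then show ?thesis using that(2) GH H' by (simp add: components_eq_iff) (simp add: component_eq_reach)
    qed
    have "component H i \<in> components H" "component H j \<in> components H"
      using assms H' by (auto simp: components_def)
    then have "(\<exists>A\<in>components H. \<exists>B\<in>components H. A \<noteq> B \<and> i \<in> A \<and> j \<in> B) \<longleftrightarrow>
        component H i \<noteq> component H j"
      using in_comp assms by blast
    then show ?thesis using GH H' assms by (simp add: components_eq_iff)
  qed
  have "{H \<in> two_tree_spanning_forests T.
             \<exists>A\<in>components H. \<exists>B\<in>components H. A \<noteq> B \<and> i \<in> A \<and> j \<in> B} =
      (\<lambda>e. delete_edges T {e}) ` {e \<in> edges T. (i, j) \<notin> reach (edges T - {e})}"
    unfolding two_tree_spanning_forests_tree[OF assms(1)] using sep by blast
  moreover have "inj_on (\<lambda>e. delete_edges T {e}) (edges T)"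
    by (auto simp: inj_on_def delete_edges_def)
  ultimately show ?thesis unfolding num_separating_forests_def
    by (simp add: card_image inj_on_subset)
qed

text \<open>With \<open>a + b = card V\<close>, each edge contributes
  \<open>2 * (2 * a - 1) * (2 * b - 1)\<close>, in which only the product \<open>a * b\<close>
  depends on the edge. The number of spanning trees in the denominator is 1.\<close>

lemma kemeny_tree:
  assumes "is_tree T"
  defines "V \<equiv> verts T" and "E \<equiv> edges T"
  shows "kemeny T = (4 * real (\<Sum>e\<in>E. edge_weight V E e) - (4 * real (card V) - 2) * real (card E)) / (4 * real (card E))"
proof -
  have T: "tree_on V E" and G: "is_graph T"
    using assms is_tree_iff_tree_on by (auto simp: is_tree_def is_forest_def)
  have fin: "finite V" "finite E" using tree_onD(1,2)[OF T] .
  let ?d = "\<lambda>x. real (degree T x)"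
  \<comment> \<open>Indicator form of the separating-forest count: one summand per edge whose
    deletion separates \<open>i\<close> from \<open>j\<close>, ready for exchanging the
    sums.\<close>
  let ?s = "\<lambda>e i j. if (i, j) \<notin> reach (E - {e}) then ?d i * ?d j else 0"
  have "(\<Sum>i\<in>V. \<Sum>j\<in>V. ?d i * real (num_separating_forests T i j) * ?d j) =
      (\<Sum>i\<in>V. \<Sum>j\<in>V. \<Sum>e\<in>E. ?s e i j)"
  proof (intro sum.cong refl)
    fix i j assume "i \<in> V" "j \<in> V"
    then have "num_separating_forests T i j = card {e \<in> E. (i, j) \<notin> reach (E - {e})}"
      using num_separating_forests_tree assms by simp
    moreover have "(\<Sum>e\<in>E. ?s e i j) = (\<Sum>e\<in>{e \<in> E. (i, j) \<notin> reach (E - {e})}. ?d i * ?d j)"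
      using fin(2) by (rule sum.inter_filter[symmetric])
    ultimately show "?d i * real (num_separating_forests T i j) * ?d j = (\<Sum>e\<in>E. ?s e i j)"
      by simp
  qed
  also have "\<dots> = (\<Sum>e\<in>E. \<Sum>i\<in>V. \<Sum>j\<in>V. ?s e i j)"
    by (simp only: sum.swap[of _ E V])
  also have "\<dots> = (\<Sum>e\<in>E. 4 * real (edge_weight V E e) - (4 * real (card V) - 2))"
  proof (intro sum.cong refl)
    fix e assume e: "e \<in> E"
    then obtain r where "r \<in> V" using tree_on_edgeE[OF T e] by metis
    then obtain A where A: "is_cut V E e A" using tree_on_cut_exists[OF T e] by blast
    note B = is_cut_compl[OF T A]
    have AV: "A \<subseteq> V" "finite A" using A fin by (auto simp: is_cut_def intro: finite_subset)
    define a b where "a = real (card A)" and "b = real (card (V - A))"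
    have ab: "a + b = real (card V)"
      unfolding a_def b_def using AV fin
      by (metis card_Diff_subset card_mono le_add_diff_inverse of_nat_add)
    \<comment> \<open>Stated for an arbitrary side \<open>C\<close>, since it is applied to both
      \<open>A\<close> and its complement.\<close>
    have vol: "(\<Sum>x\<in>C. ?d x) = 2 * real (card C) - 1" if "is_cut V E e C" for C
      using sum_degree_cut[OF G, of e C] T that by (simp add: V_def E_def flip: of_nat_sum)
    have "(\<Sum>i\<in>V. \<Sum>j\<in>V. ?s e i j) = (\<Sum>(i, j)\<in>V \<times> V. ?s e i j)"
      by (simp add: sum.cartesian_product)
    also have "\<dots> = (\<Sum>(i, j)\<in>{(i, j) \<in> V \<times> V. (i, j) \<notin> reach (E - {e})}. ?d i * ?d j)"
      using fin by (intro sum.mono_neutral_cong_right) auto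
    also have "\<dots> = (\<Sum>(i, j)\<in>A \<times> (V - A). ?d i * ?d j) + (\<Sum>(i, j)\<in>(V - A) \<times> A. ?d i * ?d j)"
      unfolding is_cut_separated_pairs[OF T A]
      using AV fin by (intro sum.union_disjoint) auto
    also have "\<dots> = 2 * ((\<Sum>i\<in>A. ?d i) * (\<Sum>j\<in>V - A. ?d j))"
      by (simp add: sum_product mult.commute flip: sum.cartesian_product)
        (simp add: sum.swap[of _ A] mult.commute)
    also have "\<dots> = 2 * ((2 * a - 1) * (2 * b - 1))"
      using vol[OF A] vol[OF B] by (simp add: a_def b_def)
    also have "\<dots> = 4 * (2 * a * b) - (4 * (a + b) - 2)"
      by (simp add: algebra_simps)
    also have "\<dots> = 4 * real (edge_weight V E e) - (4 * real (card V) - 2)"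
      by (simp only: ab) (simp add: edge_weight_cut[OF T A] a_def b_def)
    finally show "(\<Sum>i\<in>V. \<Sum>j\<in>V. ?s e i j) = 4 * real (edge_weight V E e) - (4 * real (card V) - 2)" .
  qed
  also have "\<dots> = 4 * real (\<Sum>e\<in>E. edge_weight V E e) - (4 * real (card V) - 2) * real (card E)"
    by (simp add: sum_subtractf sum_distrib_left)
  finally show ?thesis
    using num_spanning_trees_tree[OF assms(1)] by (simp add: kemeny_def V_def E_def)
qed


section \<open>Contraction and subdivision\<close>

lemma edge_weight_cut_card:
  assumes "tree_on V E" "is_cut V E e A" "card A = a" "card V = a + b"
  shows "edge_weight V E e = 2 * a * b"
proof -
  have "A \<subseteq> V" "finite A"
    using assms(1,2) tree_onD(1) by (auto simp: is_cut_def intro: finite_subset)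
  then show ?thesis using edge_weight_cut[OF assms(1,2)] assms(3,4) by (simp add: card_Diff_subset)
qed

text \<open>Only the contracted edge collapses to a singleton, so the cardinality filter amounts to
  removing it beforehand.\<close>

lemma edges_contract_edge:
  assumes "is_graph G" "{u, v} \<in> edges G"
  shows "edges (contract_edge G u v) =
    (`) (\<lambda>x. if x = u then v else x) ` (edges G - {{u, v}})" (is "_ = (`) ?h ` _")
proof -
  have uv: "u \<noteq> v" using assms by (auto simp: is_graph_def)
  have "card (?h ` e) = 2 \<longleftrightarrow> e \<noteq> {u, v}" if e: "e \<in> edges G" for e
  proof -
    have "card e = 2" using assms(1) e by (auto simp: is_graph_def)
    then obtain x y where xy: "e = {x, y}" "x \<noteq> y" by (auto simp: card_2_iff)
    have "card (?h ` e) = 2 \<longleftrightarrow> ?h x \<noteq> ?h y" unfolding xy(1) by (simp add: card_insert_if)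
    also have "\<dots> \<longleftrightarrow> e \<noteq> {u, v}" using xy uv by (auto simp: doubleton_eq_iff)
    finally show ?thesis .
  qed
  then have "{e \<in> (`) ?h ` edges G. card e = 2} = (`) ?h ` (edges G - {{u, v}})" by blast
  then show ?thesis by (simp add: contract_edge_def)
qed

lemma crosses_iff: "crosses g A \<longleftrightarrow> (\<exists>x\<in>g. x \<in> A) \<and> (\<exists>x\<in>g. x \<notin> A)"
  by (auto simp: crosses_def)

lemma crosses_image:
  assumes "\<And>x. h x \<in> B \<longleftrightarrow> x \<in> A"
  shows "crosses (h ` g) B \<longleftrightarrow> crosses g A"
  by (simp only: crosses_iff bex_simps assms)

text \<open>The preimage of \<open>A - {u}\<close> under the merging map is \<open>A\<close>,
  because \<open>u\<close> is sent to a vertex on its own side.\<close>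

lemma crosses_contract:
  assumes "u \<in> A \<longleftrightarrow> v \<in> A" "u \<noteq> v"
  shows "crosses ((\<lambda>x. if x = u then v else x) ` g) (A - {u}) \<longleftrightarrow> crosses g A"
proof -
  have "(if x = u then v else x) \<in> A - {u} \<longleftrightarrow> x \<in> A" for x using assms by auto
  then show ?thesis by (rule crosses_image)
qed

lemma is_cut_contract:
  assumes "is_cut V E f A" "{u, v} \<in> E" "f \<noteq> {u, v}" "u \<noteq> v"
  shows "is_cut (V - {u}) ((`) (\<lambda>x. if x = u then v else x) ` (E - {{u, v}}))
    ((\<lambda>x. if x = u then v else x) ` f) (A - {u})"
proof -
  have uv: "u \<in> A \<longleftrightarrow> v \<in> A" using is_cut_same_side[OF assms(1,2)] assms(3) by blast
  have "f \<in> E" "A \<subseteq> V" and cr: "\<And>g. g \<in> E \<Longrightarrow> crosses g A \<longleftrightarrow> g = f"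
    using assms(1) by (auto simp: is_cut_def)
  let ?h = "\<lambda>x. if x = u then v else x"
  have "crosses (?h ` g) (A - {u}) \<longleftrightarrow> ?h ` g = ?h ` f" if "g \<in> E" for g
  proof
    assume "crosses (?h ` g) (A - {u})"
    then have "g = f" using cr[OF that] by (simp only: crosses_contract[OF uv assms(4)])
    then show "?h ` g = ?h ` f" by (rule arg_cong)
  next
    assume "?h ` g = ?h ` f"
    moreover have "crosses (?h ` f) (A - {u})"
      using cr[OF \<open>f \<in> E\<close>] by (simp only: crosses_contract[OF uv assms(4)])
    ultimately show "crosses (?h ` g) (A - {u})" by (simp only:)
  qed
  then have "\<forall>k\<in>(`) ?h ` (E - {{u, v}}). crosses k (A - {u}) \<longleftrightarrow> k = ?h ` f"
    by (intro ballI) (elim imageE, simp only: Diff_iff)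
  moreover have "?h ` f \<in> (`) ?h ` (E - {{u, v}})" using \<open>f \<in> E\<close> assms(3) by (intro imageI) simp
  moreover have "A - {u} \<subseteq> V - {u}" using \<open>A \<subseteq> V\<close> by blast
  ultimately show ?thesis unfolding is_cut_def by (intro conjI)
qed

text \<open>No two edges become parallel: crossing the cut of \<open>f\<close> can be read off the
  image, and \<open>f\<close> alone crosses it.\<close>

lemma inj_on_contract:
  assumes "tree_on V E" "{u, v} \<in> E"
  shows "inj_on ((`) (\<lambda>x. if x = u then v else x)) (E - {{u, v}})"
proof (rule inj_onI)
  let ?h = "\<lambda>x. if x = u then v else x"
  fix f g assume fg: "f \<in> E - {{u, v}}" "g \<in> E - {{u, v}}" "?h ` f = ?h ` g"
  have uv: "u \<in> V" "u \<noteq> v" using tree_onD(3,4)[OF assms] by auto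
  then obtain A where A: "is_cut V E f A" using tree_on_cut_exists[OF assms(1)] fg(1) by blast
  then have "u \<in> A \<longleftrightarrow> v \<in> A" using is_cut_same_side[OF A assms(2)] fg(1) by blast
  then have "crosses (?h ` k) (A - {u}) \<longleftrightarrow> crosses k A" for k
    using uv(2) by (rule crosses_contract)
  from this[of f] this[of g] have "crosses g A \<longleftrightarrow> crosses f A" using fg(3) by (simp only:)
  moreover have "crosses f A" "crosses g A \<longleftrightarrow> g = f" using A fg(1,2) unfolding is_cut_def by blast+
  ultimately show "f = g" by simp
qed

lemma tree_on_contract:
  assumes T: "tree_on V E" and uv: "{u, v} \<in> E"
  shows "tree_on (V - {u}) ((`) (\<lambda>x. if x = u then v else x) ` (E - {{u, v}}))"
    (is "tree_on _ ((`) ?h ` _)")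
proof (rule tree_onI_cuts)
  have V: "u \<in> V" "v \<in> V" "u \<noteq> v" using tree_onD(3,4)[OF T uv] by auto
  show "finite (V - {u})" using tree_onD(1)[OF T] by simp
  show "\<exists>A. is_cut (V - {u}) ((`) ?h ` (E - {{u, v}})) e A" if e: "e \<in> (`) ?h ` (E - {{u, v}})" for e
  proof -
    obtain f where f: "f \<in> E" "f \<noteq> {u, v}" "e = ?h ` f" using e by (elim imageE DiffE) simp
    show ?thesis unfolding f(3)
      using is_cut_contract[OF tree_on_cut_exists[OF T f(1) V(1)] uv f(2) V(3)] by (rule exI)
  qed
  show "e \<subseteq> V - {u} \<and> card e = 2" if e: "e \<in> (`) ?h ` (E - {{u, v}})" for e
  proof -
    obtain f where f: "f \<in> E" "f \<noteq> {u, v}" "e = ?h ` f" using e by (elim imageE DiffE) simp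
    obtain x y where xy: "f = {x, y}" "x \<in> V" "y \<in> V" "x \<noteq> y" using tree_on_edgeE[OF T f(1)] .
    have "?h x \<noteq> ?h y" using f(2) xy by (auto simp: doubleton_eq_iff)
    moreover have "e = {?h x, ?h y}" unfolding f(3) xy(1) by simp
    ultimately show ?thesis using xy V by (simp add: card_insert_if)
  qed
  show "(x, y) \<in> reach ((`) ?h ` (E - {{u, v}}))" if "x \<in> V - {u}" "y \<in> V - {u}" for x y
  proof -
    have "(?h x, ?h y) \<in> reach ((`) ?h ` (E - {{u, v}}))"
    proof (rule reach_map[where h = ?h and E = E])
      show "(x, y) \<in> reach E" using tree_onD(5)[OF T] that by simp
      fix a b assume ab: "{a, b} \<in> E"
      show "(?h a, ?h b) \<in> reach ((`) ?h ` (E - {{u, v}}))"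
      proof (cases "{a, b} = {u, v}")
        case True
        then have "?h a = ?h b" by (auto simp: doubleton_eq_iff)
        then show ?thesis by simp
      next
        case False
        then have "?h ` {a, b} \<in> (`) ?h ` (E - {{u, v}})" using ab False by (intro imageI) simp
        then show ?thesis by (intro reach_edge) (simp only: image_insert image_empty)
      qed
    qed
    then show ?thesis using that by simp
  qed
qed

lemma crosses_insert: "w \<notin> g \<Longrightarrow> crosses g (insert w A) \<longleftrightarrow> crosses g A"
  by (auto simp: crosses_def)

lemma is_cutI:
  assumes "A \<subseteq> V" "e \<in> E" "crosses e A" "\<And>f. f \<in> E \<Longrightarrow> f \<noteq> e \<Longrightarrow> \<not> crosses f A"
  shows "is_cut V E e A"
  unfolding is_cut_def using assms by metis

lemma is_cutD:
  assumes "is_cut V E e A"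
  shows "A \<subseteq> V" "e \<in> E" "crosses e A" "f \<in> E \<Longrightarrow> f \<noteq> e \<Longrightarrow> \<not> crosses f A"
  using assms unfolding is_cut_def by simp_all

text \<open>Both ends of the subdivided edge lie on one side of the cut of \<open>f\<close>; the new
  vertex joins that side, so neither half crosses.\<close>

lemma is_cut_subdivide:
  assumes "tree_on V E" "w \<notin> V" "is_cut V E f A" "{u, v} \<in> E" "f \<noteq> {u, v}"
  shows "is_cut (insert w V) ((E - {{u, v}}) \<union> {{u, w}, {w, v}}) f (if v \<in> A then insert w A else A)"
    (is "is_cut _ ?F _ ?A")
proof (rule is_cutI)
  have uv: "u \<in> A \<longleftrightarrow> v \<in> A" using is_cut_same_side[OF assms(3,4)] assms(5) by simp
  note A = is_cutD[OF assms(3)]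
  have w: "w \<notin> A" using A(1) assms(2) by auto
  have cr: "crosses g ?A \<longleftrightarrow> crosses g A" if "g \<in> E" for g
  proof -
    have "w \<notin> g" using tree_onD(3)[OF assms(1) that] assms(2) by auto
    then show ?thesis by (simp add: crosses_insert)
  qed
  show "?A \<subseteq> insert w V" using A(1) by auto
  show "f \<in> ?F" using A(2) assms(5) by simp
  show "crosses f ?A" using A cr by simp
  fix g assume g: "g \<in> ?F" "g \<noteq> f"
  then consider "g \<in> E" | "g = {u, w}" | "g = {w, v}" by blast
  then show "\<not> crosses g ?A"
    using A(4)[OF _ g(2)] cr uv w by cases simp_all
qed

text \<open>The cut of the old edge serves both halves: leaving \<open>w\<close> out isolates
  \<open>{w, v}\<close>, putting it on the side of \<open>v\<close> isolates
  \<open>{u, w}\<close>.\<close>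

lemma is_cut_subdivided_edge:
  assumes "tree_on V E" "w \<notin> V" "is_cut V E {u, v} A" "v \<in> A"
  shows "is_cut (insert w V) ((E - {{u, v}}) \<union> {{u, w}, {w, v}}) {w, v} A" (is "is_cut _ ?F _ _")
    and "is_cut (insert w V) ((E - {{u, v}}) \<union> {{u, w}, {w, v}}) {u, w} (insert w A)"
proof -
  note A = is_cutD[OF assms(3)]
  have w: "w \<notin> A" using A(1) assms(2) by auto
  have u: "u \<notin> A" "u \<noteq> v" "u \<noteq> w"
    using A(3) assms(2,4) tree_onD(3)[OF assms(1) A(2)] by auto
  have cr: "\<not> crosses g A" "\<not> crosses g (insert w A)" if "g \<in> E - {{u, v}}" for g
  proof -
    show "\<not> crosses g A" using A(4) that by simp
    moreover have "w \<notin> g" using tree_onD(3)[OF assms(1), of g] that assms(2) by auto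
    ultimately show "\<not> crosses g (insert w A)" by (simp add: crosses_insert)
  qed
  show "is_cut (insert w V) ?F {w, v} A"
  proof (rule is_cutI)
    fix g assume "g \<in> ?F" "g \<noteq> {w, v}"
    then consider "g \<in> E - {{u, v}}" | "g = {u, w}" by blast
    then show "\<not> crosses g A" using cr u w by cases simp_all
  qed (use A(1) w assms(4) in auto)
  show "is_cut (insert w V) ?F {u, w} (insert w A)"
  proof (rule is_cutI)
    fix g assume "g \<in> ?F" "g \<noteq> {u, w}"
    then consider "g \<in> E - {{u, v}}" | "g = {w, v}" by blast
    then show "\<not> crosses g (insert w A)" using cr assms(4) by cases simp_all
  qed (use A(1) u in auto)
qed

lemma tree_on_subdivide:
  assumes T: "tree_on V E" and w: "w \<notin> V" and uv: "{u, v} \<in> E"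
  shows "tree_on (insert w V) ((E - {{u, v}}) \<union> {{u, w}, {w, v}})" (is "tree_on _ ?F")
proof (rule tree_onI_cuts)
  have V: "u \<in> V" "v \<in> V" "u \<noteq> v" using tree_onD(3,4)[OF T uv] by auto
  show "finite (insert w V)" using tree_onD(1)[OF T] by simp
  show "e \<subseteq> insert w V \<and> card e = 2" if e: "e \<in> ?F" for e
  proof -
    consider "e \<in> E" | "e = {u, w}" | "e = {w, v}" using e by blast
    then show ?thesis
      using tree_onD(3,4)[OF T, of e] V w by cases (auto simp: card_insert_if)
  qed
  show "\<exists>A. is_cut (insert w V) ?F e A" if e: "e \<in> ?F" for e
  proof (cases "e \<in> E - {{u, v}}")
    case True
    then have "e \<in> E" "e \<noteq> {u, v}" by simp_all
    from is_cut_subdivide[OF T w tree_on_cut_exists[OF T this(1) V(1)] uv this(2)]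
    show ?thesis by (rule exI)
  next
    case False
    have cut: "is_cut V E {u, v} {x \<in> V. (u, x) \<notin> reach (E - {{u, v}})}"
      using tree_on_cut_exists[OF T uv V(1)] .
    have "v \<in> {x \<in> V. (u, x) \<notin> reach (E - {{u, v}})}" using tree_onD(6)[OF T uv] V by simp
    note cuts = is_cut_subdivided_edge[OF T w cut this]
    consider (wv) "e = {w, v}" | (uw) "e = {u, w}" using False e by blast
    then show ?thesis
    proof cases
      case wv
      show ?thesis unfolding wv using cuts(1) by (rule exI)
    next
      case uw
      show ?thesis unfolding uw using cuts(2) by (rule exI)
    qed
  qed
  have w_reach: "(u, w) \<in> reach ?F" "(w, v) \<in> reach ?F" by (auto intro!: reach_edge)
  have lift: "(x, y) \<in> reach ?F" if "(x, y) \<in> reach E" for x y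
  proof (rule reach_map[where h = "\<lambda>x. x", OF that])
    fix a b assume ab: "{a, b} \<in> E"
    have uv_reach: "(u, v) \<in> reach ?F" "(v, u) \<in> reach ?F"
      using reach_trans[OF w_reach] reach_sym[OF reach_trans[OF w_reach]] .
    show "(a, b) \<in> reach ?F"
    proof (cases "{a, b} = {u, v}")
      case True
      then have "a = u \<and> b = v \<or> a = v \<and> b = u" by (simp add: doubleton_eq_iff)
      then show ?thesis using uv_reach by (elim disjE conjE) (simp_all only:)
    next
      case False
      then show ?thesis using ab by (intro reach_edge) simp
    qed
  qed
  have from_u: "(u, x) \<in> reach ?F" if "x \<in> insert w V" for x
    using that lift[OF tree_onD(5)[OF T V(1), of x]] w_reach(1) by (cases "x = w") simp_all
  show "(x, y) \<in> reach ?F" if "x \<in> insert w V" "y \<in> insert w V" for x y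
    using reach_join[OF from_u[OF that(1)] from_u[OF that(2)]] .
qed

section \<open>The components hanging off the path\<close>

lemma path_components:
  assumes T: "is_tree T" and l: "is_path T l" "length l = d + 1"
  defines "C \<equiv> \<lambda>i. component (delete_edges T (path_edges l)) (l ! i)"
  shows "i \<le> d \<Longrightarrow> l ! i \<in> C i"
    and "i \<le> d \<Longrightarrow> j \<le> d \<Longrightarrow> i \<noteq> j \<Longrightarrow> C i \<inter> C j = {}"
    and "(\<Union>i\<le>d. C i) = verts T"
    and "k < d \<Longrightarrow> is_cut (verts T) (edges T) {l ! k, l ! Suc k} (\<Union>i\<in>{Suc k..d}. C i)"
proof -
  let ?V = "verts T" and ?E = "edges T" and ?P = "path_edges l" and ?e = "\<lambda>k. {l ! k, l ! Suc k}"
  have Ton: "tree_on ?V ?E" and G: "is_graph T"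
    using T is_tree_iff_tree_on by (auto simp: is_tree_def is_forest_def)
  have lV: "l ! i \<in> ?V" if "i \<le> d" for i using l that by (auto simp: is_path_def)
  have P: "?P = ?e ` {..<d}" using l(2) by (auto simp: path_edges_def)
  have PE: "?P \<subseteq> ?E" using path_edges_subset[OF l(1)] .
  have inj: "inj_on ?e {..<d}"
    using l by (auto simp: inj_on_def is_path_def doubleton_eq_iff nth_eq_iff_index_eq)
  have C: "C i = {x \<in> ?V. (l ! i, x) \<in> reach (?E - ?P)}" if "i \<le> d" for i
    unfolding C_def by (rule component_delete_edges[OF G lV[OF that]])
  show refl: "l ! i \<in> C i" if "i \<le> d" for i using C lV that by simp
  have disj_less: "C i \<inter> C j = {}" if ij: "i < j" "j \<le> d" for i j
  proof (rule ccontr)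
    assume "C i \<inter> C j \<noteq> {}"
    then obtain x where "x \<in> C i" "x \<in> C j" by blast
    then have "(l ! i, x) \<in> reach (?E - ?P)" "(l ! j, x) \<in> reach (?E - ?P)"
      using C ij by simp_all
    then have "(l ! i, l ! j) \<in> reach (?E - ?P)"
      by (rule reach_trans[OF _ reach_sym])
    moreover have "?e i \<in> ?P" using P ij by simp
    ultimately have "(l ! i, l ! j) \<in> reach (?E - {?e i})" by (elim reach_mono) blast
    \<comment> \<open>The rest of the path from \<open>l ! Suc i\<close> to \<open>l ! j\<close>
      closes a detour around the edge with index \<open>i\<close>, which is a bridge.\<close>
    moreover have "(l ! Suc i, l ! (Suc i + (j - Suc i))) \<in> reach (?E - {?e i})"
    proof (rule reach_mono[OF reach_nth], safe)
      fix k assume k: "k \<in> {Suc i..<Suc i + (j - Suc i)}"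
      show "?e k \<in> ?E" using P PE k ij by auto
      show False if "?e k = ?e i" using inj_onD[OF inj that] k ij by simp
    qed
    ultimately have "(l ! i, l ! Suc i) \<in> reach (?E - {?e i})"
      using ij by (simp add: Suc_le_eq) (rule reach_trans[OF _ reach_sym])
    then show False using tree_onD(6)[OF Ton, of "l ! i" "l ! Suc i"] \<open>?e i \<in> ?P\<close> PE by blast
  qed
  show disj: "C i \<inter> C j = {}" if "i \<le> d" "j \<le> d" "i \<noteq> j" for i j
  proof (cases "i < j")
    case True
    then show ?thesis using disj_less that by simp
  next
    case False
    then show ?thesis using disj_less[of j i] that by (simp add: Int_commute)
  qed
  show "(\<Union>i\<le>d. C i) = ?V"
  proof
    show "(\<Union>i\<le>d. C i) \<subseteq> ?V" using C by auto
    show "?V \<subseteq> (\<Union>i\<le>d. C i)"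
    proof
      fix x assume x: "x \<in> ?V"
      have "(l ! 0, x) \<in> reach ?E" using tree_onD(5)[OF Ton] lV x by simp
      \<comment> \<open>Along a walk from \<open>l ! 0\<close>, each step over a path edge restarts
        at a path vertex, and every other step stays in the current component.\<close>
      then have "\<exists>i\<le>d. (l ! i, x) \<in> reach (?E - ?P)"
      proof (induction rule: reach_induct)
        case refl
        then show ?case by (intro exI[of _ 0]) simp
      next
        case (step y z)
        show ?case
        proof (cases "{y, z} \<in> ?P")
          case True
          then obtain k where "k < d" "z = l ! k \<or> z = l ! Suc k" using P by (auto simp: doubleton_eq_iff)
          then have "\<exists>i\<le>d. z = l ! i" using Suc_leI less_imp_le by blast
          then show ?thesis by (elim ex_forward) simp
        next
          case False
          then have yz: "(y, z) \<in> reach (?E - ?P)" using step(2) by (intro reach_edge) simp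
          show ?thesis using step.IH reach_trans[OF _ yz] by (elim ex_forward) simp
        qed
      qed
      then show "x \<in> (\<Union>i\<le>d. C i)" using C x by auto
    qed
  qed
  assume k: "k < d"
  let ?A = "\<Union>i\<in>{Suc k..d}. C i"
  have mem: "l ! j \<in> ?A \<longleftrightarrow> Suc k \<le> j" if "j \<le> d" for j
  proof -
    have "l ! j \<in> C i \<longleftrightarrow> i = j" if "i \<le> d" for i
      using refl[OF \<open>j \<le> d\<close>] disj[OF that \<open>j \<le> d\<close>] by (cases "i = j") auto
    then show ?thesis using \<open>j \<le> d\<close> by auto
  qed
  have "crosses f ?A \<longleftrightarrow> f = ?e k" if f: "f \<in> ?E" for f
  proof (cases "f \<in> ?P")
    case True
    then obtain j where j: "f = ?e j" "j < d" using P by auto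
    then have "crosses f ?A \<longleftrightarrow> j = k" using mem[of j] mem[of "Suc j"] by auto
    also have "\<dots> \<longleftrightarrow> f = ?e k" using inj_onD[OF inj, of j k] j k by auto
    finally show ?thesis .
  next
    case False
    obtain x y where xy: "f = {x, y}" "x \<in> ?V" "y \<in> ?V" using tree_on_edgeE[OF Ton f] by metis
    then have xy_reach: "(x, y) \<in> reach (?E - ?P)" using f False by (intro reach_edge) simp
    have "x \<in> C i \<longleftrightarrow> y \<in> C i" if "i \<le> d" for i
      using C[OF that] xy reach_trans[OF _ xy_reach] reach_trans[OF _ reach_sym[OF xy_reach]]
      by simp blast
    then have "\<not> crosses f ?A" using xy by simp
    moreover have "f \<noteq> ?e k" using False P k by auto
    ultimately show ?thesis by simp
  qed
  moreover have "?A \<subseteq> ?V" using C by auto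
  moreover have "?e k \<in> ?E" using P PE k by auto
  ultimately show "is_cut ?V ?E (?e k) ?A" by (intro is_cutI) (simp_all del: crosses_pair)
qed


section \<open>Comparison of the edge weights of the two trees\<close>

lemma contract_subdivide_path:
  fixes T1 T2 :: "'a ugraph" and d t :: nat
  assumes T: "is_tree T1" and l: "is_path T1 l" "length l = d + 1" and d: "d \<ge> 2"
    and w: "w \<notin> verts (contract_edge T1 (l ! 0) (l ! 1))"
    and T2: "T2 = subdivide_edge (contract_edge T1 (l ! 0) (l ! 1)) (l ! (d - 1)) (l ! d) w"
    and t: "t \<ge> 2"
    and card_lt: "\<forall>i<d. card (component (delete_edges T1 (path_edges l)) (l ! i)) = t"
    and card_d: "card (component (delete_edges T1 (path_edges l)) (l ! d)) = t - 1"
  shows "is_tree T2" "card (verts T2) = card (verts T1)"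
    "(\<Sum>e\<in>edges T2. edge_weight (verts T2) (edges T2) e) =
     (\<Sum>e\<in>edges T1. edge_weight (verts T1) (edges T1) e)"
proof -
  define V E where "V = verts T1" and "E = edges T1"
  define C where "C = (\<lambda>i. component (delete_edges T1 (path_edges l)) (l ! i))"
  define e where "e = (\<lambda>k. {l ! k, l ! Suc k})"
  define h where "h = (\<lambda>x. if x = l ! 0 then l ! 1 else x)"
  define Vc Ec where "Vc = V - {l ! 0}" and "Ec = (`) h ` (E - {e 0})"
  define V' E' where "V' = verts T2" and "E' = edges T2"
  \<comment> \<open>\<open>A k\<close> is the side of \<open>e k\<close> that contains
    \<open>l ! d\<close>.\<close>
  define A where "A = (\<lambda>k. \<Union>i\<in>{Suc k..d}. C i)"
  have Ton: "tree_on V E" and G: "is_graph T1"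
    using T is_tree_iff_tree_on by (auto simp: V_def E_def is_tree_def is_forest_def)
  note fin = tree_onD(1,2)[OF Ton]
  have C: "component (delete_edges T1 (path_edges l)) (l ! i) = C i" for i
    by (simp add: C_def)
  note comps = path_components[OF T l, unfolded C, folded V_def E_def]
  have P: "path_edges l = e ` {..<d}" using l(2) by (auto simp: path_edges_def e_def)
  have PE: "e k \<in> E" if "k < d" for k
    using path_edges_subset[OF l(1)] P that by (auto simp: E_def)
  have dist: "l ! i = l ! j \<longleftrightarrow> i = j" if "i \<le> d" "j \<le> d" for i j
    using l that by (simp add: is_path_def nth_eq_iff_index_eq)
  have lV: "l ! i \<in> V" if "i \<le> d" for i
    using l that by (auto simp: is_path_def V_def)
  have inj_e: "inj_on e {..<d}"
    by (auto simp: inj_on_def e_def doubleton_eq_iff dist)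
  have e0: "e 0 = {l ! 0, l ! 1}" and ed: "e (d - 1) = {l ! (d - 1), l ! d}"
    using d by (simp_all add: e_def)
  have e0E: "{l ! 0, l ! 1} \<in> E" and e0_ed: "e 0 \<noteq> e (d - 1)"
    using PE[of 0] inj_onD[OF inj_e, of 0 "d - 1"] d e0 by auto
  have ed_E: "e (d - 1) \<in> E - {e 0}" using PE[of "d - 1"] d e0_ed by simp
  \<comment> \<open>The last path edge does not contain \<open>l ! 0\<close>; for
    \<open>d = 2\<close> it starts at the merged vertex \<open>l ! 1\<close>, which \<open>h\<close>
    fixes.\<close>
  have hed: "h ` e (d - 1) = e (d - 1)"
    unfolding ed using d dist[of 0 "d - 1"] dist[of 0 d] by (simp add: h_def)
  have Tc: "tree_on Vc Ec"
    using tree_on_contract[OF Ton e0E] by (simp only: Vc_def Ec_def h_def e0)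
  have edEc: "{l ! (d - 1), l ! d} \<in> Ec"
    using imageI[OF ed_E, of "(`) h"] unfolding Ec_def hed unfolding ed .
  \<comment> \<open>Freshness is relative to the contracted tree, so \<open>w\<close> may reuse the
    discarded name \<open>l ! 0\<close>.\<close>
  have wVc: "w \<notin> Vc" using w by (simp add: Vc_def V_def contract_edge_def)
  have V': "V' = insert w Vc"
    by (simp add: V'_def T2 subdivide_edge_def contract_edge_def Vc_def V_def)
  have "edges (contract_edge T1 (l ! 0) (l ! 1)) = Ec"
    using edges_contract_edge[OF G, of "l ! 0" "l ! 1"] e0E by (simp only: E_def Ec_def h_def e0)
  then have E': "E' = (Ec - {{l ! (d - 1), l ! d}}) \<union> {{l ! (d - 1), w}, {w, l ! d}}"
    by (simp add: E'_def T2 subdivide_edge_def)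
  have T': "tree_on V' E'"
    using tree_on_subdivide[OF Tc wVc edEc] by (simp only: V' E')
  show "is_tree T2"
    using T' by (simp add: is_tree_iff_tree_on V'_def E'_def) (simp flip: V'_def add: V')
  have card_V': "card V' = card V"
    using fin lV[of 0] wVc by (simp add: V' Vc_def) (metis card_gt_0_iff Suc_pred empty_iff)
  then show "card (verts T2) = card (verts T1)" by (simp add: V_def V'_def)

  have inj_h: "inj_on ((`) h) (E - {e 0})"
    using inj_on_contract[OF Ton e0E] by (simp only: h_def e0)
  \<comment> \<open>Using the side \<open>B\<close> away from \<open>l ! 0\<close>, contraction
    leaves the set unchanged, and subdivision adds at most \<open>w\<close>.\<close>
  have cut_h: "is_cut V' E' (h ` f) (if l ! d \<in> B then insert w B else B)"
    if f: "f \<in> E" "f \<noteq> e 0" "f \<noteq> e (d - 1)" and B: "is_cut V E f B" "l ! 0 \<notin> B" for f B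
  proof -
    have "l ! 0 \<noteq> l ! 1" using dist[of 0 1] d by simp
    from is_cut_contract[OF B(1) e0E f(2)[unfolded e0] this] have "is_cut Vc Ec (h ` f) (B - {l ! 0})"
      by (simp only: Vc_def Ec_def h_def e0)
    moreover have "B - {l ! 0} = B" using B(2) by simp
    ultimately have "is_cut Vc Ec (h ` f) B" by (simp only:)
    moreover have "h ` f \<noteq> {l ! (d - 1), l ! d}"
    proof
      assume "h ` f = {l ! (d - 1), l ! d}"
      then have "h ` f = h ` e (d - 1)" unfolding hed unfolding ed .
      then have "f = e (d - 1)" using f(1,2) by (intro inj_onD[OF inj_h _ _ ed_E]) simp_all
      then show False using f(3) by contradiction
    qed
    ultimately show ?thesis
      using is_cut_subdivide[OF Tc wVc _ edEc] by (simp only: V' E')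
  qed

  have finC: "finite (C i)" if "i \<le> d" for i
    using comps(3) fin(1) that by (metis UN_upper atMost_iff finite_subset)
  have card_UN: "card (\<Union>i\<in>I. C i) = (\<Sum>i\<in>I. card (C i))" if "I \<subseteq> {..d}" for I
  proof (rule card_UN_disjoint)
    have le: "i \<le> d" if "i \<in> I" for i using that \<open>I \<subseteq> {..d}\<close> by auto
    show "finite I" using that by (rule finite_subset) simp
    show "\<forall>i\<in>I. finite (C i)" using le finC by simp
    show "\<forall>i\<in>I. \<forall>j\<in>I. i \<noteq> j \<longrightarrow> C i \<inter> C j = {}" using le comps(2) by simp
  qed
  have cardC: "card (C i) = t" if "i < d" for i using card_lt that by (simp add: C_def)
  have cardCd: "card (C d) = t - 1" using card_d by (simp add: C_def)
  have card_A: "card (A k) = (d - k) * t - 1" if "k < d" for k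
  proof -
    have split: "{Suc k..d} = insert d {Suc k..<d}" using that by auto
    have "card (A k) = (\<Sum>i\<in>{Suc k..d}. card (C i))"
      unfolding A_def by (rule card_UN) auto
    also have "\<dots> = card (C d) + (\<Sum>i\<in>{Suc k..<d}. card (C i))"
      unfolding split by simp
    also have "\<dots> = (t - 1) + (d - Suc k) * t" by (simp add: cardC cardCd)
    also have "\<dots> = (d - k) * t - 1" using that t by (simp add: Suc_diff_Suc flip: mult_Suc)
    finally show ?thesis .
  qed
  have "card V = (\<Sum>i\<le>d. card (C i))" using card_UN[of "{..d}"] comps(3) by simp
  also have "\<dots> = d * t + (t - 1)"
    by (simp add: cardC cardCd flip: lessThan_Suc_atMost)
  finally have card_V: "card V = (d + 1) * t - 1" using t by simp
  have cutA: "is_cut V E (e k) (A k)" if "k < d" for k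
    using comps(4)[OF that] by (simp add: A_def e_def)
  have d_A: "l ! d \<in> A k" if "k < d" for k
    using comps(1)[of d] that by (auto simp: A_def)
  have zero_A: "l ! 0 \<notin> A k" for k
    using comps(1)[of 0] comps(2)[of 0] by (auto simp: A_def disjoint_iff)
  have A_V: "A k \<subseteq> Vc" if "k < d" for k
    using cutA[OF that] zero_A by (auto simp: is_cut_def Vc_def)
  have card_insert_A: "card (insert w (A k)) = (d - k) * t" if "k < d" for k
  proof -
    have "w \<notin> A k" "finite (A k)"
      using A_V[OF that] wVc fin(1) by (auto simp: Vc_def intro: finite_subset)
    moreover have "(d - k) * t > 0" using that t by simp
    ultimately show ?thesis using card_A[OF that] by simp
  qed
  \<comment> \<open>Far plus near side in two forms: the missing vertex is on the far side in
    \<open>T1\<close> and on the near side in \<open>T2\<close>.\<close>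
  have V_split: "card V = ((d - k) * t - 1) + (k + 1) * t" "card V = (d - k) * t + ((k + 1) * t - 1)"
    if "k < d" for k
  proof -
    have "(d + 1) * t = (d - k) * t + (k + 1) * t" using that by (simp flip: add_mult_distrib)
    moreover have "(d - k) * t > 0" "(k + 1) * t > 0" using that t by simp_all
    ultimately show "card V = ((d - k) * t - 1) + (k + 1) * t" "card V = (d - k) * t + ((k + 1) * t - 1)"
      using card_V by linarith+
  qed

  \<comment> \<open>\<open>\<omega> k\<close> is the weight of \<open>e k\<close> in
    \<open>T1\<close>. Replacing \<open>k\<close> by \<open>d - 1 - k\<close> exchanges
    \<open>d - k\<close> with \<open>k + 1\<close>, which moves the \<open>- 1\<close> to the other
    factor.\<close>
  define \<omega> where "\<omega> = (\<lambda>k. 2 * ((d - k) * t - 1) * ((k + 1) * t))"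
  have \<omega>_rev: "\<omega> (d - 1 - k) = 2 * ((d - k) * t) * ((k + 1) * t - 1)" if "k < d" for k
  proof -
    have "d - (d - 1 - k) = k + 1" "d - 1 - k + 1 = d - k" using that by linarith+
    then show ?thesis unfolding \<omega>_def by (simp only: mult_ac)
  qed
  have W: "edge_weight V E (e k) = \<omega> k" if "k < d" for k
    unfolding \<omega>_def by (rule edge_weight_cut_card[OF Ton cutA card_A V_split(1)]) (use that in simp_all)
  \<comment> \<open>In \<open>T1\<close> the edge \<open>e k\<close> has \<open>(k + 1) * t\<close> vertices on the side of \<open>l ! 0\<close>; in \<open>T2\<close> it loses
    \<open>l ! 0\<close> there and gains \<open>w\<close> on the other side, which then has \<open>(d - k) * t\<close> vertices.\<close>
  have W'_path: "edge_weight V' E' (h ` e k) = \<omega> (d - 1 - k)" if "1 \<le> k" "k < d - 1" for k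
  proof -
    have k: "k < d" "e k \<noteq> e 0" "e k \<noteq> e (d - 1)"
      using that inj_on_eq_iff[OF inj_e, of k 0] inj_on_eq_iff[OF inj_e, of k "d - 1"] by auto
    have cut: "is_cut V' E' (h ` e k) (insert w (A k))"
      using cut_h[OF PE[OF k(1)] k(2,3) cutA[OF k(1)] zero_A] d_A[OF k(1)] by simp
    show ?thesis unfolding \<omega>_rev[OF k(1)]
      by (rule edge_weight_cut_card[OF T' cut card_insert_A[OF k(1)]])
        (simp only: card_V' V_split(2)[OF k(1)])
  qed
  \<comment> \<open>The path avoids \<open>f\<close>, so both its ends lie outside the side
    \<open>B\<close> away from \<open>l ! 0\<close>. Neither operation touches \<open>B\<close>, and
    the order of the tree is unchanged.\<close>
  have W'_nonpath: "edge_weight V' E' (h ` f) = edge_weight V E f" if f: "f \<in> E" "f \<notin> e ` {..<d}" for f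
  proof -
    define B where "B = {x \<in> V. (l ! 0, x) \<notin> reach (E - {f})}"
    have B: "is_cut V E f B" unfolding B_def by (rule tree_on_cut_exists[OF Ton f(1) lV]) simp
    have "(l ! 0, l ! (0 + d)) \<in> reach (E - {f})"
      by (rule reach_mono[OF reach_nth]) (use f PE in \<open>auto simp: e_def\<close>)
    then have "l ! 0 \<notin> B" "l ! d \<notin> B" by (simp_all add: B_def)
    moreover have "f \<noteq> e 0" "f \<noteq> e (d - 1)" using f(2) d by auto
    ultimately have cut: "is_cut V' E' (h ` f) B" using cut_h[OF f(1) _ _ B] by simp
    have "card V = card B + (card V - card B)"
      using is_cut_psubset(1)[OF Ton B] fin(1) by (simp add: card_mono psubset_imp_subset)
    then show ?thesis
      using edge_weight_cut_card[OF Ton B refl] edge_weight_cut_card[OF T' cut refl] card_V' by metis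
  qed
  have cutAc: "is_cut Vc Ec {l ! (d - 1), l ! d} (A (d - 1))"
  proof -
    have "l ! 0 \<noteq> l ! 1" using dist[of 0 1] d by simp
    from is_cut_contract[OF cutA e0E e0_ed[symmetric, unfolded e0] this] d
    have "is_cut Vc Ec (h ` e (d - 1)) (A (d - 1) - {l ! 0})"
      by (simp add: Vc_def Ec_def h_def e0)
    moreover have "A (d - 1) - {l ! 0} = A (d - 1)" using zero_A by simp
    ultimately show ?thesis by (simp only: hed) (simp only: ed)
  qed
  have dA: "l ! d \<in> A (d - 1)" using d_A d by simp
  note cuts = is_cut_subdivided_edge[OF Tc wVc cutAc dA, folded V' E']
  \<comment> \<open>Beyond \<open>{w, l ! d}\<close> lies \<open>A (d - 1)\<close>, just as beyond
    the old last edge.\<close>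
  have W'_wd: "edge_weight V' E' {w, l ! d} = \<omega> (d - 1)"
    unfolding \<omega>_def using d
    by (intro edge_weight_cut_card[OF T' cuts(1)]) (simp_all only: card_V' card_A V_split(1)[of "d - 1"])
  \<comment> \<open>Here \<open>w\<close> completes the far side to \<open>t\<close> vertices, the
    near-side size of the contracted edge \<open>e 0\<close>; this is the reversed weight at
    \<open>k = d - 1\<close>.\<close>
  have W'_dw: "edge_weight V' E' {l ! (d - 1), w} = \<omega> 0"
  proof -
    have "\<omega> (d - 1 - (d - 1)) = 2 * ((d - (d - 1)) * t) * ((d - 1 + 1) * t - 1)"
      using d by (intro \<omega>_rev) simp
    moreover have "edge_weight V' E' {l ! (d - 1), w} = 2 * ((d - (d - 1)) * t) * ((d - 1 + 1) * t - 1)"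
      using d by (intro edge_weight_cut_card[OF T' cuts(2)])
        (simp_all only: card_V' card_insert_A V_split(2)[of "d - 1"])
    ultimately show ?thesis by simp
  qed

  \<comment> \<open>\<open>N\<close> holds the edges off the path and \<open>M\<close> the indices
    of the interior path edges, with \<open>M\<close> empty for \<open>d = 2\<close>. Only the
    interior edges are reversed among themselves.\<close>
  define N M where "N = E - e ` {..<d}" and "M = {1..<d - 1}"
  have M: "{..<d} = insert 0 (insert (d - 1) M)" using d by (auto simp: M_def)
  have M_notin: "0 \<notin> insert (d - 1) M" "d - 1 \<notin> M" using d by (auto simp: M_def)
  have X: "E - {e 0} - {e (d - 1)} = N \<union> e ` M"
  proof -
    have "M \<subseteq> {..<d}" using M by blast
    then have "e 0 \<notin> e ` M" "e (d - 1) \<notin> e ` M"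
      using inj_on_image_mem_iff[OF inj_e, of 0 M] inj_on_image_mem_iff[OF inj_e, of "d - 1" M]
        d M_notin \<open>M \<subseteq> {..<d}\<close> by simp_all
    moreover have "e ` M \<subseteq> E" using PE by (auto simp: M_def)
    ultimately show ?thesis unfolding N_def M by auto
  qed
  have w_notin: "w \<notin> f" if "f \<in> Ec" for f using tree_onD(3)[OF Tc that] wVc by auto
  have "Ec - {h ` e (d - 1)} = (`) h ` (E - {e 0} - {e (d - 1)})"
    using inj_on_image_set_diff[OF inj_h, of "E - {e 0}" "{e (d - 1)}"] ed_E
    by (simp add: Ec_def)
  then have E'_eq: "E' = insert {l ! (d - 1), w} (insert {w, l ! d} ((`) h ` (N \<union> e ` M)))"
    unfolding X hed unfolding E' ed by auto
  have XE: "N \<union> e ` M \<subseteq> E - {e 0}" using X by auto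
  then have "(`) h ` (N \<union> e ` M) \<subseteq> Ec" unfolding Ec_def by (rule image_mono)
  then have notin: "{l ! (d - 1), w} \<notin> (`) h ` (N \<union> e ` M)" "{w, l ! d} \<notin> (`) h ` (N \<union> e ` M)"
    using w_notin by blast+
  have "l ! (d - 1) \<noteq> l ! d" using dist d by simp
  then have ne: "{l ! (d - 1), w} \<noteq> {w, l ! d}" by (auto simp: doubleton_eq_iff)
  have finN: "finite N" "finite M" using fin by (simp_all add: N_def M_def)
  have "(\<Sum>g\<in>E'. edge_weight V' E' g) =
      \<omega> 0 + (\<omega> (d - 1) + (\<Sum>g\<in>(`) h ` (N \<union> e ` M). edge_weight V' E' g))"
  proof -
    let ?W = "edge_weight V' E'" and ?X = "(`) h ` (N \<union> e ` M)"
    have "sum ?W (insert {l ! (d - 1), w} (insert {w, l ! d} ?X)) =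
        ?W {l ! (d - 1), w} + (?W {w, l ! d} + sum ?W ?X)"
      using finN notin ne by (simp add: sum.insert)
    then show ?thesis by (simp only: W'_dw W'_wd E'_eq[symmetric])
  qed
  also have "(\<Sum>g\<in>(`) h ` (N \<union> e ` M). edge_weight V' E' g) =
      (\<Sum>f\<in>N \<union> e ` M. edge_weight V' E' (h ` f))"
    using sum.reindex[OF inj_on_subset[OF inj_h XE]] by simp
  also have "\<dots> = (\<Sum>f\<in>N. edge_weight V' E' (h ` f)) + (\<Sum>f\<in>e ` M. edge_weight V' E' (h ` f))"
    using finN M by (intro sum.union_disjoint) (auto simp: N_def)
  also have "(\<Sum>f\<in>N. edge_weight V' E' (h ` f)) = (\<Sum>f\<in>N. edge_weight V E f)"
    by (intro sum.cong refl W'_nonpath) (auto simp: N_def)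
  also have "(\<Sum>f\<in>e ` M. edge_weight V' E' (h ` f)) = (\<Sum>k\<in>M. edge_weight V' E' (h ` e k))"
    using inj_on_subset[OF inj_e, of M] M by (subst sum.reindex) auto
  also have "\<dots> = (\<Sum>k\<in>M. \<omega> (d - 1 - k))"
    by (intro sum.cong refl W'_path) (auto simp: M_def)
  also have "\<dots> = (\<Sum>k\<in>M. \<omega> k)"
    by (rule sum.reindex_bij_witness[of _ "\<lambda>k. d - 1 - k" "\<lambda>k. d - 1 - k"]) (auto simp: M_def)
  \<comment> \<open>The two halves of the subdivided edge supply the weights of the two end edges
    that \<open>M\<close> omits.\<close>
  also have "\<omega> 0 + (\<omega> (d - 1) + ((\<Sum>f\<in>N. edge_weight V E f) + (\<Sum>k\<in>M. \<omega> k))) =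
      (\<Sum>f\<in>N. edge_weight V E f) + (\<Sum>k<d. \<omega> k)"
    unfolding M using finN M_notin by simp
  also have "(\<Sum>k<d. \<omega> k) = (\<Sum>f\<in>e ` {..<d}. edge_weight V E f)"
    by (simp add: sum.reindex[OF inj_e] W)
  also have "(\<Sum>f\<in>N. edge_weight V E f) + \<dots> = (\<Sum>f\<in>E. edge_weight V E f)"
    unfolding N_def using fin PE by (intro sum.subset_diff[symmetric]) auto
  finally show "(\<Sum>e\<in>edges T2. edge_weight (verts T2) (edges T2) e) =
     (\<Sum>e\<in>edges T1. edge_weight (verts T1) (edges T1) e)"
    by (simp only: V_def E_def V'_def E'_def)
qed

theorem mainTheorem6:
  fixes T1 T2 :: "'a ugraph" and i1 i2 w :: 'a and l :: "'a list" and d t :: nat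
  assumes "is_tree T1"
    and "i1 \<in> verts T1" and "i2 \<in> verts T1" and "i1 \<noteq> i2"
    and "is_path T1 l" and "length l = d + 1" and "l ! 0 = i1" and "l ! d = i2"
    and "d \<ge> 2"
    and "w \<notin> verts (contract_edge T1 (l ! 0) (l ! 1))"
    and "T2 = subdivide_edge (contract_edge T1 (l ! 0) (l ! 1)) (l ! (d - 1)) (l ! d) w"
    and "t \<ge> 2"
    and "\<forall>i<d. card (component (delete_edges T1 (path_edges l)) (l ! i)) = t"
    and "card (component (delete_edges T1 (path_edges l)) (l ! d)) = t - 1"
  shows "kemeny T1 = kemeny T2 \<and> (\<not> isomorphic T1 T2 \<longrightarrow> co_kemeny_mates T1 T2)"
proof -
  note T2 = contract_subdivide_path[OF assms(1,5,6,9-14)]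
  \<comment> \<open>Equal orders give equal edge numbers, so all quantities in
    \<open>kemeny_tree\<close> agree for the two trees.\<close>
  have "card (edges T) + 1 = card (verts T)" if "is_tree T" for T :: "'a ugraph"
    using card_edges_tree_on that by (auto simp: is_tree_iff_tree_on)
  from this[OF assms(1)] this[OF T2(1)] have "card (edges T1) = card (edges T2)"
    using T2(2) by simp
  then have "kemeny T1 = kemeny T2"
    using kemeny_tree[OF assms(1)] kemeny_tree[OF T2(1)] T2(2,3) by simp
  moreover have "2 \<le> card (verts T1)"
  proof -
    have "finite (verts T1)" using assms(1) by (auto simp: is_tree_def is_forest_def is_graph_def)
    then show ?thesis using card_mono[of "verts T1" "{i1, i2}"] assms(2-4) by simp
  qed
  ultimately show ?thesis
    using assms(1) T2(1,2) by (simp add: co_kemeny_mates_def is_tree_def is_forest_def)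
qed

end
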